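(* Let $k \geq 2$ and $2 \leq j \leq k+1$ be integers. Then there exists a finite set of permutations $S$ such that $M_{k,j,j} \subseteq S$ and $|\mathrm{Av}_n(M_{k,j,j-1})| = |\mathrm{Av}_n(S)|$ for all positive integers $n$.
   Context: Permutations are written in one-line notation. A permutation $p=p_1\cdots p_n\in\mathfrak{S}_n$ contains $q=q_1\cdots q_m\in\mathfrak{S}_m$ if there are indices $i_1<\dots<i_m$ such that $q_a<q_b \iff p_{i_a}<p_{i_b}$ for all $a,b$; otherwise $p$ avoids $q$. For a set $Q$ of permutations (possibly of different lengths), $\mathrm{Av}_n(Q)$ is the set of all $p\in\mathfrak{S}_n$ avoiding every element of $Q$. For integers $k\ge 1$ and $1\le i,j\le k+1$, $M_{k,j,i}$ denotes the following set of $k$ permutations of length $k+1$: all $\pi\in\mathfrak{S}_{k+1}$ such that $\pi_j\neq i$ and the word obtained from $\pi_1\cdots\pi_{k+1}$ by deleting the entry $\pi_j$ in position $j$ is increasing. (Equivalently, for each value $v\in\{1,\dots,k+1\}\setminus\{i\}$, take the permutation with $v$ in position $j$ and the remaining values in increasing order in the remaining positions.) For example, $M_{3,3,2}=\{2314,1234,1243\}$. *)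

theory Defs
  imports "HOL-Combinatorics.Combinatorics"
begin

(* Permutations of {1..n} are lists in one-line notation: the entry that is written
   p_i (with i counted from 1) is p ! (i - 1). *)

definition perms :: "nat \<Rightarrow> nat list set" where
  "perms n = permutations_of_set {1..n}"

definition contains :: "nat list \<Rightarrow> nat list \<Rightarrow> bool" where
  "contains p q \<longleftrightarrow>
     (\<exists>f :: nat \<Rightarrow> nat. strict_mono_on {..<length q} f \<and>
        (\<forall>a<length q. f a < length p) \<and>
        (\<forall>a<length q. \<forall>b<length q. q ! a < q ! b \<longleftrightarrow> p ! f a < p ! f b))"

definition avoids :: "nat list \<Rightarrow> nat list \<Rightarrow> bool" where
  "avoids p q \<longleftrightarrow> \<not> contains p q"

definition Av :: "nat \<Rightarrow> nat list set \<Rightarrow> nat list set" where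
  "Av n Q = {p \<in> perms n. \<forall>q\<in>Q. avoids p q}"

(* k, j, i are in the order of the subscripts of M_{k,j,i}: j is the (1-based) position
   of the entry to delete, i is the value that this entry must not have. *)

definition M :: "nat \<Rightarrow> nat \<Rightarrow> nat \<Rightarrow> nat list set" where
  "M k j i = {p \<in> perms (k + 1). p ! (j - 1) \<noteq> i \<and>
                sorted_wrt (<) (take (j - 1) p @ drop j p)}"

end

(* Extend p by the points (0, 0) and (n+1, n+1), and put t = j - 2, s = k + 1 - j. The core of p is
   the set of positions that can serve as the (j-1)-st term of an increasing subsequence of length k.
   Avoiding M k j (j-1) or M k j j says what may stand between the (j-1)-st and the j-th term x, y of
   such a subsequence (v being the term before x): every entry there lies between v and x in the first
   case, between x and y in the second. All these positions are then in the core themselves, so the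
   core falls into runs of consecutive positions, on which p is decreasing in the first case and
   increasing in the second. Reversing every run preserves the core, and hence is an involution
   between the two classes, up to one defect: after the reversal of decreasing runs all entries of a
   run have the same chains below them. This extra condition forbids configurations of
   boundedly many points, so it amounts to avoiding finitely many further permutations. *)

theory Submission
  imports Defs
begin

section \<open>Reversing the runs of a set of positions\<close>

text \<open>Unless \<open>x = y\<close>, one of the two intervals is empty, so their union is the
  interval between \<open>x\<close> and \<open>y\<close> in either order. The classes of this
  relation on \<open>C\<close> are its maximal blocks of consecutive numbers.\<close>

definition same_run :: "nat set \<Rightarrow> nat \<Rightarrow> nat \<Rightarrow> bool" where
  "same_run C x y \<longleftrightarrow> {x..y} \<union> {y..x} \<subseteq> C"

definition flip :: "nat set \<Rightarrow> nat \<Rightarrow> nat" where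
  "flip C x = (if x \<in> C then Min {y. same_run C x y} + Max {y. same_run C x y} - x else x)"

lemma same_run_sym: "same_run C x y \<longleftrightarrow> same_run C y x"
  by (simp add: same_run_def Un_commute)

lemma same_run_trans: "same_run C x y \<Longrightarrow> same_run C y z \<Longrightarrow> same_run C x z"
  unfolding same_run_def subset_iff Un_iff atLeastAtMost_iff by (meson linear)

lemma same_run_mem: "same_run C x y \<Longrightarrow> x \<in> C \<and> y \<in> C"
  unfolding same_run_def subset_iff Un_iff atLeastAtMost_iff by (meson linear order_refl)

lemma same_run_refl: "x \<in> C \<Longrightarrow> same_run C x x"
  unfolding same_run_def by simp

lemma same_run_between: "same_run C x y \<Longrightarrow> x \<le> z \<Longrightarrow> z \<le> y \<Longrightarrow> same_run C x z"
  unfolding same_run_def subset_iff by auto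

text \<open>A run is closed under betweenness and finite, hence an interval. Two of its points are
  treated together because they are reflected in the same ends \<open>l\<close> and
  \<open>h\<close>.\<close>

lemma run_interval:
  assumes "finite C"
  shows "same_run C x y \<Longrightarrow> \<exists>l h. {z. same_run C x z} = {l..h} \<and> x \<in> {l..h} \<and> y \<in> {l..h}
    \<and> flip C x = l + h - x \<and> flip C y = l + h - y"
proof -
  assume xy: "same_run C x y"
  let ?A = "{y. same_run C x y}"
  have eq: "{z. same_run C y z} = ?A" using xy same_run_trans same_run_sym by blast
  have fin: "finite ?A"
    using same_run_mem by (intro finite_subset[OF _ assms(1)]) blast
  have xA: "x \<in> ?A" "y \<in> ?A" using same_run_mem[OF xy] xy same_run_refl by auto
  have "?A = {Min ?A..Max ?A}"
  proof
    show "?A \<subseteq> {Min ?A..Max ?A}" using fin by auto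
    show "{Min ?A..Max ?A} \<subseteq> ?A"
    proof
      fix z assume z: "z \<in> {Min ?A..Max ?A}"
      have "Min ?A \<in> ?A" "Max ?A \<in> ?A" using fin xA Min_in Max_in by blast+
      then show "z \<in> ?A"
        using z same_run_between same_run_sym same_run_trans
        by (metis atLeastAtMost_iff mem_Collect_eq)
    qed
  qed
  then have "?A = {Min ?A..Max ?A} \<and> x \<in> {Min ?A..Max ?A} \<and> y \<in> {Min ?A..Max ?A}
      \<and> flip C x = Min ?A + Max ?A - x \<and> flip C y = Min ?A + Max ?A - y"
    using same_run_mem[OF xy] eq xA by (simp add: flip_def)
  then show ?thesis by blast
qed

context
  fixes C :: "nat set"
  assumes fin: "finite C"
begin

lemma flip_same_run: "x \<in> C \<Longrightarrow> same_run C x (flip C x)"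
proof -
  assume "x \<in> C"
  then obtain l h where *: "{z. same_run C x z} = {l..h}" "x \<in> {l..h}" "flip C x = l + h - x"
    using run_interval[OF fin same_run_refl] by blast
  have "flip C x \<in> {l..h}" using * by auto
  then show ?thesis using *(1) by blast
qed

lemma flip_outside: "x \<notin> C \<Longrightarrow> flip C x = x"
  by (simp add: flip_def)

lemma flip_mem: "flip C x \<in> C \<longleftrightarrow> x \<in> C"
  using flip_same_run same_run_mem flip_outside by metis

lemma flip_flip: "flip C (flip C x) = x"
proof (cases "x \<in> C")
  case True
  then obtain l h where "x \<in> {l..h}" "flip C x = l + h - x" "flip C (flip C x) = l + h - flip C x"
    using run_interval[OF fin flip_same_run] by blast
  then show ?thesis by auto
qed (simp add: flip_def)

lemma same_run_flip_iff: "same_run C (flip C x) (flip C y) \<longleftrightarrow> same_run C x y"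
  using flip_same_run same_run_mem same_run_trans same_run_sym flip_mem by meson

lemma flip_less_same: "x < y \<Longrightarrow> same_run C x y \<Longrightarrow> flip C y < flip C x"
  using run_interval[OF fin, of x y] by auto

text \<open>Otherwise the stretches from \<open>x\<close> to its image and from \<open>y\<close> to
  its image would together cover everything between \<open>x\<close> and \<open>y\<close>. Each
  stretch is a single fixed point or lies in \<open>C\<close>, so \<open>x\<close> and
  \<open>y\<close> would share a run.\<close>

lemma flip_less_diff:
  assumes "x < y" "\<not> same_run C x y"
  shows "flip C x < flip C y"
proof (rule ccontr)
  assume neg: "\<not> ?thesis"
  have near: "{x..flip C x} \<union> {flip C x..x} \<subseteq> C \<or> x = flip C x" for x
    using flip_same_run[of x] flip_outside[of x] unfolding same_run_def by metis
  have "z \<in> C" if "x \<le> z" "z \<le> y" for z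
    using near[of x] near[of y] that assms(1) neg unfolding subset_iff Un_iff atLeastAtMost_iff
    by (smt (verit) linorder_not_less order.trans order.order_iff_strict)
  then show False using assms unfolding same_run_def by auto
qed

end

section \<open>Chains and their core\<close>

definition asc :: "nat \<Rightarrow> (nat \<Rightarrow> nat) \<Rightarrow> nat rel" where
  "asc N P = {(x, y). x < y \<and> y \<le> N \<and> P x < P y}"

definition core :: "nat \<Rightarrow> (nat \<Rightarrow> nat) \<Rightarrow> nat \<Rightarrow> nat \<Rightarrow> nat set" where
  "core N P t s = {x. (0, x) \<in> asc N P ^^ Suc t \<and> (x, N) \<in> asc N P ^^ Suc s}"

text \<open>The points 0 and N are sentinels: a pair (0, v) in the t-th power of asc is an increasing
  subsequence of t genuine entries that ends in v, and v is the sentinel 0 if t = 0; similarly at the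
  other end. With t = j - 2 and s = k + 1 - j the next two predicates are the avoidance of M k j (j - 1)
  and of M k j j; the third describes the defect of the reversal map.\<close>

definition down_gap :: "nat \<Rightarrow> (nat \<Rightarrow> nat) \<Rightarrow> nat \<Rightarrow> nat \<Rightarrow> bool" where
  "down_gap N P t s \<longleftrightarrow> (\<forall>v x e y. (0, v) \<in> asc N P ^^ t \<longrightarrow> (v, x) \<in> asc N P \<longrightarrow>
     (x, y) \<in> asc N P \<longrightarrow> (y, N) \<in> asc N P ^^ s \<longrightarrow> x < e \<longrightarrow> e < y \<longrightarrow> P v < P e \<and> P e < P x)"

definition up_gap :: "nat \<Rightarrow> (nat \<Rightarrow> nat) \<Rightarrow> nat \<Rightarrow> nat \<Rightarrow> bool" where
  "up_gap N P t s \<longleftrightarrow> (\<forall>v x e y. (0, v) \<in> asc N P ^^ t \<longrightarrow> (v, x) \<in> asc N P \<longrightarrow>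
     (x, y) \<in> asc N P \<longrightarrow> (y, N) \<in> asc N P ^^ s \<longrightarrow> x < e \<longrightarrow> e < y \<longrightarrow> P x < P e \<and> P e < P y)"

definition no_overlap :: "nat \<Rightarrow> (nat \<Rightarrow> nat) \<Rightarrow> nat \<Rightarrow> nat \<Rightarrow> bool" where
  "no_overlap N P t s \<longleftrightarrow> (\<forall>v f e y. (0, v) \<in> asc N P ^^ t \<longrightarrow> (0, f) \<in> asc N P ^^ Suc t \<longrightarrow>
     v < f \<longrightarrow> f < e \<longrightarrow> (v, e) \<in> asc N P \<longrightarrow> (e, y) \<in> asc N P \<longrightarrow> (y, N) \<in> asc N P ^^ s \<longrightarrow> \<not> P f < P v)"

lemma asc_trans: "(x, y) \<in> asc N P \<Longrightarrow> (y, z) \<in> asc N P \<Longrightarrow> (x, z) \<in> asc N P"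
  by (auto simp: asc_def)

text \<open>Transitivity lengthens the last link, so the number of links is unchanged. There has to
  be a last link, hence \<open>Suc r\<close>.\<close>

lemma asc_pow_snoc: "(a, u) \<in> asc N P ^^ Suc r \<Longrightarrow> (u, w) \<in> asc N P \<Longrightarrow> (a, w) \<in> asc N P ^^ Suc r"
  by (meson asc_trans relpow_Suc_E relpow_Suc_I)

lemma asc_pow_cons: "(u, b) \<in> asc N P ^^ Suc r \<Longrightarrow> (w, u) \<in> asc N P \<Longrightarrow> (w, b) \<in> asc N P ^^ Suc r"
  by (meson asc_trans relpow_Suc_E2 relpow_Suc_I2)

lemma relpow_map:
  assumes "(a, b) \<in> R ^^ r" "\<And>x y. (x, y) \<in> R \<Longrightarrow> (g x, g y) \<in> S"
  shows "(g a, g b) \<in> S ^^ r"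
  using assms(1) by (induction r arbitrary: b) (use assms(2) in \<open>auto\<close>)

lemma core_I:
  "(0, v) \<in> asc N P ^^ t \<Longrightarrow> (v, x) \<in> asc N P \<Longrightarrow> (x, y) \<in> asc N P \<Longrightarrow> (y, N) \<in> asc N P ^^ s
   \<Longrightarrow> x \<in> core N P t s"
  unfolding core_def by (blast intro: relpow_Suc_I relpow_Suc_I2)

lemma core_E:
  assumes "x \<in> core N P t s"
  obtains v y where "(0, v) \<in> asc N P ^^ t" "(v, x) \<in> asc N P" "(x, y) \<in> asc N P"
    "(y, N) \<in> asc N P ^^ s"
  using assms unfolding core_def by (blast elim: relpow_Suc_E relpow_Suc_E2)

lemma core_subset: "core N P t s \<subseteq> {1..<N}"
  by (auto elim!: core_E simp: asc_def)

lemma finite_core: "finite (core N P t s)"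
  by (rule finite_subset[OF core_subset]) simp

text \<open>Under either condition an entry in the gap has its value between those of
  \<open>v\<close> and \<open>y\<close>, so it can take the place of \<open>x\<close> in the
  chain.\<close>

lemma core_between:
  assumes "down_gap N P t s \<or> up_gap N P t s"
    "x \<in> core N P t s" "(x, y) \<in> asc N P" "(y, N) \<in> asc N P ^^ s"
  shows "{x..<y} \<subseteq> core N P t s"
proof
  fix e assume e: "e \<in> {x..<y}"
  obtain v where v: "(0, v) \<in> asc N P ^^ t" "(v, x) \<in> asc N P" by (rule core_E[OF assms(2)])
  show "e \<in> core N P t s"
  proof (cases "e = x")
    case False
    then have "x < e" "e < y" using e by auto
    then have "P v < P e \<and> P e < P x \<or> P x < P e \<and> P e < P y"
      using assms(1,3,4) v unfolding down_gap_def up_gap_def by blast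
    then have "(v, e) \<in> asc N P" "(e, y) \<in> asc N P"
      using v(2) assms(3) \<open>x < e\<close> \<open>e < y\<close> by (auto simp: asc_def)
    then show ?thesis using core_I v(1) assms(4) by blast
  qed (use assms in simp)
qed

section \<open>Reversal exchanges decreasing and increasing runs\<close>

locale chains =
  fixes N t s :: nat and P :: "nat \<Rightarrow> nat"
begin

abbreviation "R \<equiv> asc N P"
abbreviation "C \<equiv> core N P t s"
definition "\<sigma> = flip C"
definition "P' = P \<circ> \<sigma>"
abbreviation "R' \<equiv> asc N P'"

lemma core_bounds: "0 \<notin> C" "N \<notin> C" "\<And>x. x \<in> C \<Longrightarrow> x < N"
  using core_subset by fastforce+

lemma finite_C: "finite C" by (rule finite_core)

lemmas flip_run = flip_same_run[OF finite_C, folded \<sigma>_def]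
lemmas flip_in_core = flip_mem[OF finite_C, folded \<sigma>_def]
lemmas flip_invol = flip_flip[OF finite_C, folded \<sigma>_def]
lemmas flip_run_iff = same_run_flip_iff[OF finite_C, folded \<sigma>_def]
lemmas flip_reverse = flip_less_same[OF finite_C, folded \<sigma>_def]
lemmas flip_mono = flip_less_diff[OF finite_C, folded \<sigma>_def]
lemmas flip_fixed = flip_outside[OF finite_C, folded \<sigma>_def]

lemma flip_ends: "\<sigma> 0 = 0" "\<sigma> N = N" "x \<le> N \<Longrightarrow> \<sigma> x \<le> N"
  subgoal using flip_fixed core_bounds by blast
  subgoal using flip_fixed core_bounds by blast
  subgoal using flip_fixed[of x] core_bounds(3)[of "\<sigma> x"] flip_in_core[of x] by fastforce
  done

lemma flip_asc_iff: "(u, w) \<in> R' \<longleftrightarrow> u < w \<and> w \<le> N \<and> P (\<sigma> u) < P (\<sigma> w)"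
  by (simp add: asc_def P'_def)

lemma asc_iff: "(u, w) \<in> R \<longleftrightarrow> u < w \<and> w \<le> N \<and> P u < P w"
  by (simp add: asc_def)

text \<open>Points in different runs keep their relative position under \<open>\<sigma>\<close>, so
  only pairs inside one run can be gained or lost between \<open>R\<close> and
  \<open>R'\<close>.\<close>

lemma asc_of_flip: "(u, w) \<in> R' \<Longrightarrow> \<not> same_run C u w \<Longrightarrow> (\<sigma> u, \<sigma> w) \<in> R"
  unfolding asc_iff flip_asc_iff using flip_mono[of u w] flip_ends(3)[of w] by simp

lemma flip_of_asc: "(u, w) \<in> R \<Longrightarrow> \<not> same_run C u w \<Longrightarrow> (\<sigma> u, \<sigma> w) \<in> R'"
  unfolding asc_iff flip_asc_iff flip_invol using flip_mono[of u w] flip_ends(3)[of w] by simp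

lemma core_iff: "x \<in> C \<longleftrightarrow> (0, x) \<in> R ^^ Suc t \<and> (x, N) \<in> R ^^ Suc s"
  unfolding core_def by blast

lemma core_flip_iff: "x \<in> core N P' t s \<longleftrightarrow> (0, x) \<in> R' ^^ Suc t \<and> (x, N) \<in> R' ^^ Suc s"
  unfolding core_def by blast

section \<open>From decreasing runs to increasing runs\<close>

context
  assumes A: "down_gap N P t s"
begin

lemma down_gapD:
  assumes "(0, v) \<in> R ^^ t" "(v, x) \<in> R" "(x, y) \<in> R" "(y, N) \<in> R ^^ s" "x < e" "e < y"
  shows "P v < P e" "P e < P x"
  using A assms unfolding down_gap_def by blast+

text \<open>If \<open>x\<close> were below \<open>x'\<close>, a successor \<open>y\<close> of
  \<open>x'\<close> would also be a successor of \<open>x\<close>; then \<open>x'\<close> stands in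
  the gap after \<open>x\<close> and has to be smaller.\<close>

lemma core_antichain:
  assumes "x \<in> C" "x' \<in> C"
  shows "(x, x') \<notin> R"
proof
  assume R: "(x, x') \<in> R"
  obtain v where v: "(0, v) \<in> R ^^ t" "(v, x) \<in> R" using core_E[OF assms(1)] .
  obtain y where y: "(x', y) \<in> R" "(y, N) \<in> R ^^ s" using core_E[OF assms(2)] .
  have "P x' < P x" using down_gapD(2)[OF v asc_trans[OF R y(1)] y(2)] R y(1) by (simp add: asc_iff)
  then show False using R by (simp add: asc_iff)
qed

lemma run_up_to_down: "x \<in> C \<Longrightarrow> (x, y) \<in> R \<Longrightarrow> (y, N) \<in> R ^^ s \<Longrightarrow> {x..<y} \<subseteq> C"
  using core_between[of N P t s x y] A by blast

lemma asc_not_same_run: "(u, w) \<in> R \<Longrightarrow> \<not> same_run C u w"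
  using core_antichain[of u w] same_run_mem[of C u w] by blast

text \<open>The next chain term \<open>y\<close> after \<open>z\<close> is not met inside the run,
  where it would be a core element above \<open>z\<close>. So \<open>z'\<close> stands in the gap
  before \<open>y\<close>.\<close>

lemma run_decreasing:
  assumes "z < z'" "same_run C z z'"
  shows "P z' < P z"
proof -
  have c: "z \<in> C" using assms same_run_mem by blast
  obtain v y where vy: "(0, v) \<in> R ^^ t" "(v, z) \<in> R" "(z, y) \<in> R" "(y, N) \<in> R ^^ s"
    using core_E[OF c] .
  have "\<not> y \<le> z'"
  proof
    assume "y \<le> z'"
    then have "same_run C z y" using same_run_between[OF assms(2)] vy(3) by (simp add: asc_iff)
    then show False using asc_not_same_run vy(3) by blast
  qed
  then show ?thesis using down_gapD[OF vy assms(1)] by simp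
qed

lemma flip_run_increasing: "z < z' \<Longrightarrow> same_run C z z' \<Longrightarrow> P' z < P' z'"
  using run_decreasing[OF flip_reverse] flip_run_iff same_run_sym unfolding P'_def by simp

lemma flip_asc: "(u, w) \<in> R \<Longrightarrow> (\<sigma> u, \<sigma> w) \<in> R'"
  using flip_of_asc asc_not_same_run by blast

text \<open>No link of \<open>R\<close> stays inside a run, so \<open>\<sigma>\<close> carries whole
  chains of \<open>P\<close> to chains of \<open>P'\<close>; this is applied to the chains through
  \<open>\<sigma> x\<close>.\<close>

lemma core_subset_flip: "C \<subseteq> core N P' t s"
proof
  fix x assume x: "x \<in> C"
  then have "\<sigma> x \<in> C" using flip_in_core by blast
  then have "(0, \<sigma> x) \<in> R ^^ Suc t" "(\<sigma> x, N) \<in> R ^^ Suc s" unfolding core_iff by blast+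
  then have "(\<sigma> 0, \<sigma> (\<sigma> x)) \<in> R' ^^ Suc t" "(\<sigma> (\<sigma> x), \<sigma> N) \<in> R' ^^ Suc s"
    using relpow_map[where R = R and g = \<sigma> and S = R'] flip_asc by blast+
  then show "x \<in> core N P' t s" unfolding core_flip_iff by (simp only: flip_invol flip_ends)
qed

text \<open>Followed back from \<open>w\<close>, the chain runs through points fixed by
  \<open>\<sigma>\<close>, and its links are links of \<open>R\<close>, until it meets the core at
  some \<open>u\<close>; then \<open>\<sigma> u\<close> is a core element below
  \<open>w\<close>.\<close>

lemma flip_chain_to: "(0, w) \<in> R' ^^ r \<Longrightarrow> w \<notin> C \<Longrightarrow> (0, w) \<in> R ^^ r \<or> (\<exists>c\<in>C. (c, w) \<in> R)"
proof (induction r arbitrary: w)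
  case (Suc r)
  then obtain u where u: "(0, u) \<in> R' ^^ r" "(u, w) \<in> R'" by (auto elim: relpow_Suc_E)
  have "\<not> same_run C u w" using Suc.prems same_run_mem by blast
  then have st: "(\<sigma> u, w) \<in> R" using asc_of_flip[OF u(2)] flip_fixed Suc.prems by simp
  show ?case
  proof (cases "u \<in> C")
    case True then show ?thesis using st flip_in_core by blast
  next
    case False
    then have "(u, w) \<in> R" using st flip_fixed by simp
    then show ?thesis
      using Suc.IH[OF u(1) False] asc_trans[where y = u and z = w] relpow_Suc_I[of 0 u r R w]
      by blast
  qed
qed auto

lemma flip_chain_from: "(w, N) \<in> R' ^^ r \<Longrightarrow> w \<notin> C \<Longrightarrow> (w, N) \<in> R ^^ r \<or> (\<exists>c\<in>C. (w, c) \<in> R)"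
proof (induction r arbitrary: w)
  case (Suc r)
  then obtain u where u: "(u, N) \<in> R' ^^ r" "(w, u) \<in> R'" by (meson relpow_Suc_E2)
  have "\<not> same_run C w u" using Suc.prems same_run_mem by blast
  then have st: "(w, \<sigma> u) \<in> R" using asc_of_flip[OF u(2)] flip_fixed Suc.prems by simp
  show ?case
  proof (cases "u \<in> C")
    case True then show ?thesis using st flip_in_core by blast
  next
    case False
    then have "(w, u) \<in> R" using st flip_fixed by simp
    then show ?thesis
      using Suc.IH[OF u(1) False] asc_trans[where x = w and y = u] relpow_Suc_I2[of w u R N r]
      by blast
  qed
qed auto

text \<open>Otherwise \<open>w\<close> would be in the core itself, since the chain to
  \<open>c\<close> can be redirected to \<open>w\<close>, and the core is an antichain.\<close>

lemma no_chain_above_core: "c \<in> C \<Longrightarrow> (c, w) \<in> R \<Longrightarrow> (w, N) \<notin> R ^^ Suc s"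
  using core_antichain[of c w] core_iff[of c] core_iff[of w] asc_pow_snoc[of 0 c t N P w] by blast

lemma no_chain_below_core: "c \<in> C \<Longrightarrow> (w, c) \<in> R \<Longrightarrow> (0, w) \<notin> R ^^ Suc t"
  using core_antichain[of w c] core_iff[of c] core_iff[of w] asc_pow_cons[of c N s N P w] by blast

text \<open>For \<open>x\<close> outside \<open>C\<close>, each of its two chains in
  \<open>P'\<close> either survives in \<open>P\<close> or yields a core element on that side. Two
  survivors put \<open>x\<close> into \<open>C\<close>, one contradicts
  \<open>no_chain_above_core\<close> or \<open>no_chain_below_core\<close>, and none gives two
  comparable core elements.\<close>

lemma core_flip_down: "core N P' t s = C"
proof
  show "core N P' t s \<subseteq> C"
  proof (rule subsetI, rule ccontr)
    fix x assume x: "x \<in> core N P' t s" "x \<notin> C"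
    consider "(0, x) \<in> R ^^ Suc t" | c where "c \<in> C" "(c, x) \<in> R"
      using flip_chain_to[of x "Suc t"] x core_flip_iff[of x] by blast
    then show False
    proof cases
      case 1
      then show ?thesis
        using flip_chain_from[of x "Suc s"] x core_flip_iff[of x] core_iff[of x]
          no_chain_below_core[of _ x] by blast
    next
      case 2
      then show ?thesis
        using flip_chain_from[of x "Suc s"] x core_flip_iff[of x] no_chain_above_core[of c x]
          core_antichain[of c] asc_trans[where x = c and y = x] by blast
    qed
  qed
qed (rule core_subset_flip)

lemma flip_asc_same_run: "(x, y) \<in> R' \<Longrightarrow> x \<in> C \<Longrightarrow> y \<in> C \<Longrightarrow> same_run C x y"
  using asc_of_flip[of x y] core_antichain[of "\<sigma> x" "\<sigma> y"] flip_in_core by blast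

text \<open>Everything from a core point up to its successor is core, while the successor is not. So
  the successor is always the first position outside the core to the right of the run.\<close>

lemma run_next:
  assumes "same_run C x x'" "(x, y) \<in> R" "(y, N) \<in> R ^^ s"
  shows "(x', y) \<in> R"
proof -
  have C: "x \<in> C" "x' \<in> C" using assms same_run_mem by blast+
  obtain y' where y': "(x', y') \<in> R" "(y', N) \<in> R ^^ s" using core_E[OF C(2)] .
  have ns: "y \<notin> C" "y' \<notin> C" using core_antichain assms(2) y' C by blast+
  have sub: "{x..<y} \<subseteq> C" "{x'..<y'} \<subseteq> C" "{x..x'} \<union> {x'..x} \<subseteq> C"
    using run_up_to_down C assms y' unfolding same_run_def by blast+
  have "x < y" "x' < y'" using assms y' by (simp_all add: asc_iff)
  have "y = y'"
  proof (rule ccontr)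
    assume "y \<noteq> y'"
    then have "y \<in> {x'..<y'} \<union> ({x..x'} \<union> {x'..x}) \<or> y' \<in> {x..<y} \<union> ({x..x'} \<union> {x'..x})"
      using \<open>x < y\<close> \<open>x' < y'\<close> by auto
    then show False using sub ns by blast
  qed
  then show ?thesis using y' by simp
qed

lemma up_gap_flip: "up_gap N P' t s" unfolding up_gap_def
proof (intro allI impI)
  fix v x e y assume a: "(0, v) \<in> asc N P' ^^ t" "(v, x) \<in> asc N P'" "(x, y) \<in> asc N P'"
    "(y, N) \<in> asc N P' ^^ s" "x < e" "e < y"
  have x: "x \<in> C" using core_I[OF a(1-4)] core_flip_down by blast
  show "P' x < P' e \<and> P' e < P' y"
  proof (cases "y \<in> C")
    case True
    then have xy: "same_run C x y" using flip_asc_same_run x a(3) by blast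
    then have xe: "same_run C x e" using same_run_between a(5,6) by simp
    then have "same_run C e y" using xy same_run_sym same_run_trans by blast
    then show ?thesis using flip_run_increasing xe a(5,6) by blast
  next
    case False
    have sx: "\<sigma> x \<in> C" using x flip_in_core by blast
    have "\<not> same_run C x y" using False same_run_mem by blast
    then have st: "(\<sigma> x, y) \<in> R" using asc_of_flip[OF a(3)] flip_fixed[OF False] by simp
    \<comment> \<open>The other alternative of \<open>flip_chain_from\<close> would put a core
      element above \<open>\<sigma> x\<close>.\<close>
    have y: "(y, N) \<in> R ^^ s"
      using flip_chain_from[of y s] False a(4) core_antichain[OF sx] asc_trans[OF st] by blast
    have "{\<sigma> x..<y} \<subseteq> C" using run_up_to_down sx st y by blast
    moreover have sr: "same_run C x (\<sigma> x)" using flip_run[OF x] .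
    ultimately have sub: "{x..<y} \<subseteq> C" unfolding same_run_def by (auto simp: subset_iff)
    then have e: "same_run C x e" "e \<in> C" using a(5,6) unfolding same_run_def by auto
    have "same_run C (\<sigma> x) (\<sigma> e)" using e(1) flip_run_iff by blast
    then have "(\<sigma> e, y) \<in> R" using run_next st y by blast
    then have "P' e < P' y" using flip_fixed[OF False] by (simp add: P'_def asc_iff)
    then show ?thesis using flip_run_increasing[OF a(5) e(1)] by blast
  qed
qed

text \<open>In a violation \<open>f\<close> and \<open>e\<close> share a run, so in \<open>P\<close>
  the point \<open>\<sigma> f\<close> stands in the gap after \<open>\<sigma> e\<close>. The lower
  bound in \<open>down_gap\<close> then places its value above that of \<open>v\<close>.\<close>

lemma no_overlap_flip: "no_overlap N P' t s" unfolding no_overlap_def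
proof (intro allI impI notI)
  fix v f e y assume a: "(0, v) \<in> asc N P' ^^ t" "(0, f) \<in> asc N P' ^^ Suc t" "v < f" "f < e"
    "(v, e) \<in> asc N P'" "(e, y) \<in> asc N P'" "(y, N) \<in> asc N P' ^^ s" "P' f < P' v"
  have eC: "e \<in> C" using core_I[OF a(1,5-7)] core_flip_down by blast
  have fe: "(f, e) \<in> asc N P'" using a by (auto simp: asc_def)
  have "(e, N) \<in> asc N P' ^^ Suc s" using a(6,7) by (rule relpow_Suc_I2)
  then have "(f, N) \<in> asc N P' ^^ Suc s" using fe by (rule asc_pow_cons)
  then have fC: "f \<in> C" using core_flip_down core_flip_iff[of f] a(2) by blast
  have run: "same_run C f e" using flip_asc_same_run fe fC eC by blast
  have nv: "\<not> same_run C v f" using flip_run_increasing[OF a(3)] a(8) by fastforce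
  have vC: "v \<notin> C"
  proof
    assume "v \<in> C"
    then have "same_run C v e" using flip_asc_same_run a(5) eC by blast
    then show False using nv run same_run_trans same_run_sym by blast
  qed
  have sC: "\<sigma> e \<in> C" "\<sigma> f \<in> C" using eC fC flip_in_core by blast+
  have "\<not> same_run C v e" using vC same_run_mem by blast
  then have ve: "(v, \<sigma> e) \<in> R" using asc_of_flip[of v e] a(5) flip_fixed[OF vC] by simp
  then have v: "(0, v) \<in> R ^^ t"
    using flip_chain_to[of v t] a(1) vC core_antichain[OF _ sC(1)] asc_trans[OF _ ve] by blast
  obtain y' where y': "(\<sigma> e, y') \<in> R" "(y', N) \<in> R ^^ s" using core_E[OF sC(1)] .
  have lt: "\<sigma> e < \<sigma> f" using flip_reverse run a(4) by blast
  have "same_run C (\<sigma> e) (\<sigma> f)" using run flip_run_iff same_run_sym by blast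
  then have "(\<sigma> f, y') \<in> R" using run_next y' by blast
  then have "\<sigma> f < y'" by (simp add: asc_iff)
  then have "P v < P (\<sigma> f)" using down_gapD(1)[OF v ve y' lt] by blast
  then show False using a(8) flip_fixed[OF vC] by (simp add: P'_def)
qed

end

section \<open>From increasing runs back to decreasing runs\<close>

context
  assumes B: "up_gap N P t s" and D: "no_overlap N P t s" and inj: "inj_on P {0..N}"
begin

lemma run_up_to_up: "x \<in> C \<Longrightarrow> (x, y) \<in> R \<Longrightarrow> (y, N) \<in> R ^^ s \<Longrightarrow> {x..<y} \<subseteq> C"
  using core_between[of N P t s x y] B by blast

text \<open>A successor \<open>y\<close> of \<open>w\<close> is also a successor of
  \<open>u\<close>, and all positions from \<open>u\<close> up to \<open>y\<close> are core,
  \<open>w\<close> among them.\<close>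

lemma asc_same_run:
  assumes "u \<in> C" "w \<in> C" "(u, w) \<in> R"
  shows "same_run C u w"
proof -
  obtain y where y: "(w, y) \<in> R" "(y, N) \<in> R ^^ s" using core_E[OF assms(2)] .
  have "{u..<y} \<subseteq> C" using run_up_to_up[OF assms(1) asc_trans[OF assms(3) y(1)] y(2)] .
  then show ?thesis using assms(3) y(1) unfolding same_run_def by (auto simp: asc_iff)
qed

text \<open>It suffices to compare neighbours: \<open>Suc z\<close> is either the chosen next chain
  term \<open>y\<close> after \<open>z\<close> or stands in the gap before it.\<close>

lemma run_increasing: "x < z \<Longrightarrow> same_run C x z \<Longrightarrow> P x < P z"
proof (induction z)
  case (Suc z)
  have z: "same_run C x z" using Suc.prems same_run_between by simp
  then have zC: "z \<in> C" using same_run_mem by blast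
  obtain v y where vy: "(0, v) \<in> R ^^ t" "(v, z) \<in> R" "(z, y) \<in> R" "(y, N) \<in> R ^^ s"
    using core_E[OF zC] .
  have st: "P z < P (Suc z)"
  proof (cases "y = Suc z")
    case True then show ?thesis using vy(3) by (simp add: asc_iff)
  next
    case False
    then have "Suc z < y" using vy(3) by (simp add: asc_iff)
    then show ?thesis using B vy unfolding up_gap_def by blast
  qed
  then show ?case using Suc.IH z Suc.prems(1) by (cases "x = z") auto
qed simp

lemma same_run_asc:
  assumes "x < z" "same_run C x z"
  shows "(x, z) \<in> R"
  using run_increasing[OF assms] core_bounds(3)[of z] same_run_mem[OF assms(2)] assms(1) by (simp add: asc_iff)

lemma flip_asc_not_same_run: "(u, w) \<in> R' \<Longrightarrow> \<not> same_run C u w"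
  using run_increasing[OF flip_reverse] flip_run_iff same_run_sym unfolding flip_asc_iff by (meson order_less_asym)

lemma flip_asc_imp_asc: "(u, w) \<in> R' \<Longrightarrow> (\<sigma> u, \<sigma> w) \<in> R"
  using asc_of_flip flip_asc_not_same_run by blast

text \<open>Reversed runs are decreasing, so no link of \<open>R'\<close> stays inside a run and
  \<open>\<sigma>\<close> carries chains of \<open>P'\<close> back to chains of
  \<open>P\<close>.\<close>

lemma flip_core_subset: "core N P' t s \<subseteq> C"
proof
  fix x assume x: "x \<in> core N P' t s"
  then have "(0, x) \<in> R' ^^ Suc t" "(x, N) \<in> R' ^^ Suc s" unfolding core_flip_iff by blast+
  then have "(\<sigma> 0, \<sigma> x) \<in> R ^^ Suc t" "(\<sigma> x, \<sigma> N) \<in> R ^^ Suc s"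
    using relpow_map[where R = R' and g = \<sigma> and S = R] flip_asc_imp_asc by blast+
  then have "\<sigma> x \<in> C" unfolding core_iff by (simp only: flip_ends)
  then show "x \<in> C" using flip_in_core by blast
qed

text \<open>A core element on the chain before \<open>w\<close>, together with \<open>c\<close>
  above \<open>w\<close>, would force \<open>w\<close> into the core. So \<open>\<sigma>\<close>
  fixes the whole chain and every link survives.\<close>

lemma chain_to_flip: "(0, w) \<in> R ^^ r \<Longrightarrow> w \<notin> C \<Longrightarrow> c \<in> C \<Longrightarrow> (w, c) \<in> R \<Longrightarrow> (0, w) \<in> R' ^^ r"
proof (induction r arbitrary: w)
  case (Suc r)
  then obtain u where u: "(0, u) \<in> R ^^ r" "(u, w) \<in> R" by (auto elim: relpow_Suc_E)
  have uC: "u \<notin> C"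
  proof
    assume "u \<in> C"
    then have "(0, w) \<in> R ^^ Suc t" using asc_pow_snoc[OF _ u(2)] unfolding core_iff by blast
    moreover have "(w, N) \<in> R ^^ Suc s"
      using asc_pow_cons[OF _ Suc.prems(4)] Suc.prems(3) unfolding core_iff by blast
    ultimately show False using Suc.prems(2) core_iff by blast
  qed
  have "\<not> same_run C u w" using uC same_run_mem by blast
  then have "(u, w) \<in> R'" using flip_of_asc[OF u(2)] flip_fixed[OF uC] flip_fixed[OF Suc.prems(2)] by simp
  then show ?case
    using relpow_Suc_I[OF Suc.IH[OF u(1) uC Suc.prems(3) asc_trans[OF u(2) Suc.prems(4)]]] by blast
qed auto

lemma chain_from_flip: "(w, N) \<in> R ^^ r \<Longrightarrow> w \<notin> C \<Longrightarrow> c \<in> C \<Longrightarrow> (c, w) \<in> R \<Longrightarrow> (w, N) \<in> R' ^^ r"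
proof (induction r arbitrary: w)
  case (Suc r)
  then obtain u where u: "(u, N) \<in> R ^^ r" "(w, u) \<in> R" by (meson relpow_Suc_E2)
  have uC: "u \<notin> C"
  proof
    assume "u \<in> C"
    then have "(w, N) \<in> R ^^ Suc s" using asc_pow_cons[OF _ u(2)] unfolding core_iff by blast
    moreover have "(0, w) \<in> R ^^ Suc t"
      using asc_pow_snoc[OF _ Suc.prems(4)] Suc.prems(3) unfolding core_iff by blast
    ultimately show False using Suc.prems(2) core_iff by blast
  qed
  have "\<not> same_run C w u" using uC same_run_mem by blast
  then have "(w, u) \<in> R'" using flip_of_asc[OF u(2)] flip_fixed[OF uC] flip_fixed[OF Suc.prems(2)] by simp
  then show ?case
    using relpow_Suc_I2[OF _ Suc.IH[OF u(1) uC Suc.prems(3) asc_trans[OF Suc.prems(4) u(2)]]] by blast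
qed auto

lemma core_flip_up: "core N P' t s = C"
proof
  show "C \<subseteq> core N P' t s"
  proof
    fix x assume x: "x \<in> C"
    have fin: "finite {z. same_run C x z}"
      by (rule finite_subset[OF _ finite_C]) (use same_run_mem in blast)
    define lo hi where "lo = Min {z. same_run C x z}" and "hi = Max {z. same_run C x z}"
    have ne: "{z. same_run C x z} \<noteq> {}" using same_run_refl[OF x] by blast
    have lo: "same_run C x lo" and hi: "same_run C x hi"
      using Min_in[OF fin ne] Max_in[OF fin ne] unfolding lo_def hi_def by blast+
    have bnd: "lo \<le> z \<and> z \<le> hi" if "same_run C x z" for z
      using fin that unfolding lo_def hi_def by auto
    have sx: "same_run C x (\<sigma> x)" using flip_run[OF x] .
    have mem: "lo \<in> C" "hi \<in> C" "\<sigma> x \<in> C" using lo hi sx same_run_mem by blast+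
    \<comment> \<open>The neighbours are taken at the two ends of the run: inside the core they
      would extend the run, so they lie outside and are fixed by \<open>\<sigma>\<close>. As the run
      increases, they also fit around \<open>\<sigma> x\<close>.\<close>
    obtain v where v: "(0, v) \<in> R ^^ t" "(v, lo) \<in> R" using core_E[OF mem(1)] .
    obtain y where y: "(hi, y) \<in> R" "(y, N) \<in> R ^^ s" using core_E[OF mem(2)] .
    have vC: "v \<notin> C"
    proof
      assume "v \<in> C"
      then have "same_run C x v" using asc_same_run v(2) mem(1) lo same_run_sym same_run_trans by blast
      then show False using bnd v(2) by (fastforce simp: asc_iff)
    qed
    have yC: "y \<notin> C"
    proof
      assume "y \<in> C"
      then have "same_run C x y" using asc_same_run y(1) mem(2) hi same_run_trans by blast
      then show False using bnd y(1) by (fastforce simp: asc_iff)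
    qed
    have "(lo, \<sigma> x) \<in> R \<or> lo = \<sigma> x" "(\<sigma> x, hi) \<in> R \<or> \<sigma> x = hi"
      using bnd[OF sx] same_run_asc[OF _ same_run_trans[of C lo x "\<sigma> x"]]
        same_run_asc[OF _ same_run_trans[of C "\<sigma> x" x hi]] lo hi sx same_run_sym[of C x]
      by (auto simp: le_less)
    then have "(v, \<sigma> x) \<in> R" "(\<sigma> x, y) \<in> R" using asc_trans[OF v(2)] asc_trans[OF _ y(1)] v(2) y(1) by auto
    moreover have "\<not> same_run C v (\<sigma> x)" "\<not> same_run C (\<sigma> x) y" using vC yC same_run_mem by blast+
    ultimately have "(v, x) \<in> R'" "(x, y) \<in> R'"
      using flip_of_asc[of v "\<sigma> x"] flip_of_asc[of "\<sigma> x" y] by (simp_all add: flip_fixed[OF vC] flip_fixed[OF yC] flip_invol)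
    moreover have "(0, v) \<in> R' ^^ t" using chain_to_flip[OF v(1) vC mem(1) v(2)] .
    moreover have "(y, N) \<in> R' ^^ s" using chain_from_flip[OF y(2) yC mem(2) y(1)] .
    ultimately show "x \<in> core N P' t s" unfolding core_def by (blast intro: relpow_Suc_I relpow_Suc_I2)
  qed
qed (rule flip_core_subset)

lemma down_gap_flip: "down_gap N P' t s" unfolding down_gap_def
proof (intro allI impI)
  fix v x e y assume a: "(0, v) \<in> asc N P' ^^ t" "(v, x) \<in> asc N P'" "(x, y) \<in> asc N P'"
    "(y, N) \<in> asc N P' ^^ s" "x < e" "e < y"
  note a' = a(1-4)
  have x: "x \<in> C" using core_I[OF a(1-4)] core_flip_up by blast
  have sx: "\<sigma> x \<in> C" using x flip_in_core by blast
  \<comment> \<open>A link of \<open>P'\<close> between core elements would come from a link of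
    \<open>P\<close> inside one run, and such links are destroyed by the reversal.\<close>
  have out: "z \<notin> C" if "(x, z) \<in> R' \<or> (z, x) \<in> R'" for z
  proof
    assume "z \<in> C"
    then have "same_run C (\<sigma> x) (\<sigma> z)"
      using that flip_asc_imp_asc asc_same_run flip_in_core sx same_run_sym by blast
    then have "same_run C x z" using flip_run_iff by blast
    then show False using flip_asc_not_same_run that same_run_sym by blast
  qed
  have vC: "v \<notin> C" and yC: "y \<notin> C" using out a' by blast+
  have R: "(v, \<sigma> x) \<in> R" "(\<sigma> x, y) \<in> R"
    using flip_asc_imp_asc[OF a'(2)] flip_asc_imp_asc[OF a'(3)] flip_fixed[OF vC] flip_fixed[OF yC] by simp_all
  have "(\<sigma> 0, \<sigma> v) \<in> R ^^ t" "(\<sigma> y, \<sigma> N) \<in> R ^^ s"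
    using relpow_map[where R = R' and g = \<sigma> and S = R] flip_asc_imp_asc a' by blast+
  then have ch: "(0, v) \<in> R ^^ t" "(y, N) \<in> R ^^ s" by (simp_all only: flip_ends flip_fixed[OF vC] flip_fixed[OF yC])
  have "{\<sigma> x..<y} \<subseteq> C" using run_up_to_up sx R(2) ch(2) by blast
  moreover have sr: "same_run C x (\<sigma> x)" using flip_run[OF x] .
  ultimately have sub: "{x..<y} \<subseteq> C" unfolding same_run_def by (auto simp: subset_iff)
  then have e: "same_run C x e" "e \<in> C" using a(5,6) unfolding same_run_def by auto
  have lt: "\<sigma> e < \<sigma> x" using flip_reverse a(5) e(1) by blast
  have run: "same_run C (\<sigma> e) (\<sigma> x)" using e(1) flip_run_iff same_run_sym by blast
  have eC: "\<sigma> e \<in> C" using e(2) flip_in_core by blast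
  have "P (\<sigma> e) < P (\<sigma> x)" using run_increasing lt run by blast
  \<comment> \<open>Here \<open>no_overlap\<close> enters, with \<open>\<sigma> e\<close> in the
    role of \<open>f\<close> and \<open>\<sigma> x\<close> in the role of \<open>e\<close>;
    injectivity excludes equality.\<close>
  moreover have "P v < P (\<sigma> e)"
  proof (rule ccontr)
    assume neg: "\<not> ?thesis"
    have vx: "v < \<sigma> x" using R(1) by (simp add: asc_iff)
    have ve: "v < \<sigma> e"
    proof (rule ccontr)
      assume "\<not> ?thesis"
      then have "same_run C (\<sigma> e) v" using same_run_between[OF run] vx by simp
      then show False using vC same_run_mem by blast
    qed
    have "\<sigma> e < N" using eC core_bounds(3) by blast
    then have "P v \<noteq> P (\<sigma> e)" using inj ve unfolding inj_on_def by force
    then have "P (\<sigma> e) < P v" using neg by simp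
    moreover have "(0, \<sigma> e) \<in> R ^^ Suc t" using eC core_iff by blast
    ultimately show False using D ch R ve lt unfolding no_overlap_def by blast
  qed
  ultimately show "P' v < P' e \<and> P' e < P' x" using flip_fixed[OF vC] by (simp add: P'_def)
qed

end
end

section \<open>The bijection on permutations\<close>

text \<open>The identity outside the list supplies both sentinels, and it makes \<open>ext\<close>
  of a reversed permutation agree with the composition with \<open>flip\<close> at every
  argument.\<close>

definition ext :: "nat list \<Rightarrow> nat \<Rightarrow> nat" where
  "ext p i = (if 1 \<le> i \<and> i \<le> length p then p ! (i - 1) else i)"

lemma perms_iff: "p \<in> perms n \<longleftrightarrow> set p = {1..n} \<and> distinct p"
  by (auto simp: perms_def permutations_of_set_def)

lemma length_perms: "p \<in> perms n \<Longrightarrow> length p = n"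
  using distinct_card[of p] by (simp add: perms_iff)

lemma finite_perms: "finite (perms n)"
  by (simp add: perms_def)

lemma nth_perms: "p \<in> perms n \<Longrightarrow> a < n \<Longrightarrow> 1 \<le> p ! a \<and> p ! a \<le> n"
  using length_perms[of p n] nth_mem[of a p] by (auto simp: perms_iff)

lemma ext_0: "ext p 0 = 0" and ext_Suc: "a < length p \<Longrightarrow> ext p (Suc a) = p ! a"
  and ext_above: "length p < a \<Longrightarrow> ext p a = a"
  by (simp_all add: ext_def)

lemma ext_image: "set p = ext p ` {1..length p}"
proof -
  have "ext p ` {1..length p} = (\<lambda>a. p ! a) ` {..<length p}"
    by (force simp: ext_def image_iff Bex_def intro: exI[of _ "Suc _"])
  then show ?thesis by (auto simp: set_conv_nth)
qed

lemma ext_range: "p \<in> perms n \<Longrightarrow> 1 \<le> a \<Longrightarrow> a \<le> n \<Longrightarrow> 1 \<le> ext p a \<and> ext p a \<le> n"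
  using nth_perms[of p n "a - 1"] length_perms[of p n] by (simp add: ext_def)

lemma inj_ext: "p \<in> perms n \<Longrightarrow> inj_on (ext p) {0..Suc n}"
proof (rule inj_onI)
  fix a b assume p: "p \<in> perms n" and ab: "a \<in> {0..Suc n}" "b \<in> {0..Suc n}" "ext p a = ext p b"
  have d: "distinct p" and l: "length p = n" using p perms_iff length_perms by auto
  have c: "c = 0 \<and> ext p c = 0 \<or> c = Suc n \<and> ext p c = Suc n \<or>
      1 \<le> c \<and> c \<le> n \<and> 1 \<le> ext p c \<and> ext p c \<le> n \<and> ext p c = p ! (c - 1)" if "c \<le> Suc n" for c
    using that ext_range[OF p, of c] l by (cases "c = 0"; cases "c = Suc n") (auto simp: ext_def)
  have "a = b" if "1 \<le> a" "a \<le> n" "1 \<le> b" "b \<le> n" "p ! (a - 1) = p ! (b - 1)"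
  proof -
    have "a - 1 < length p" "b - 1 < length p" using that l by linarith+
    then have "a - 1 = b - 1" using nth_eq_iff_index_eq[OF d] that(5) by blast
    then show ?thesis using that by linarith
  qed
  then show "a = b"
    using c[of a] c[of b] ab by auto
qed

definition flip_perm :: "nat \<Rightarrow> nat \<Rightarrow> nat list \<Rightarrow> nat list" where
  "flip_perm t s p = map (ext p \<circ> flip (core (Suc (length p)) (ext p) t s)) [1..<Suc (length p)]"

lemma length_flip_perm [simp]: "length (flip_perm t s p) = length p"
  by (simp add: flip_perm_def del: upt_Suc)

lemma ext_flip_perm:
  "ext (flip_perm t s p) = ext p \<circ> flip (core (Suc (length p)) (ext p) t s)"
proof
  fix i
  interpret chains "Suc (length p)" t s "ext p" .
  have "\<sigma> 0 = 0" "Suc (length p) \<le> i \<Longrightarrow> \<sigma> i = i" using flip_ends(1) flip_fixed core_bounds(3)[of i] by fastforce+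
  then show "ext (flip_perm t s p) i = (ext p \<circ> flip (core (Suc (length p)) (ext p) t s)) i"
    by (cases "i = 0") (auto simp: ext_def flip_perm_def \<sigma>_def simp del: upt_Suc)
qed

lemma flip_perm_in_perms:
  assumes p: "p \<in> perms n"
  shows "flip_perm t s p \<in> perms n"
proof -
  interpret chains "Suc (length p)" t s "ext p" .
  have l: "length p = n" using p length_perms by blast
  have "\<sigma> x \<in> {1..n}" if "x \<in> {1..n}" for x
  proof -
    have "\<sigma> x = y \<Longrightarrow> \<sigma> y = y \<Longrightarrow> x = y" for y using flip_invol[of x] by simp
    then have "\<sigma> x \<noteq> 0" "\<sigma> x \<noteq> Suc n" using flip_ends(1,2) that unfolding l by fastforce+
    then show ?thesis using flip_ends(3)[of x] that unfolding l by auto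
  qed
  moreover from this have "x \<in> \<sigma> ` {1..n}" if "x \<in> {1..n}" for x
    using flip_invol[of x] that by (metis image_eqI)
  ultimately have im: "\<sigma> ` {1..n} = {1..n}" by blast
  have "set (flip_perm t s p) = ext p ` \<sigma> ` {1..n}"
    by (simp add: ext_image[of "flip_perm t s p"] ext_flip_perm \<sigma>_def image_comp flip: l)
  also have "\<dots> = {1..n}" using im ext_image[of p] p perms_iff l by simp
  finally have "set (flip_perm t s p) = {1..n}" .
  moreover from this have "distinct (flip_perm t s p)" using l by (intro card_distinct) simp
  ultimately show ?thesis by (simp add: perms_iff)
qed

lemma eq_of_ext: "length p = length q \<Longrightarrow> ext p = ext q \<Longrightarrow> p = q"
  by (rule nth_equalityI, simp) (metis ext_Suc)

text \<open>Since the core is unchanged, the second reversal acts on the same runs as the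
  first.\<close>

lemma flip_perm_flip_perm:
  assumes "core (Suc (length p)) (ext (flip_perm t s p)) t s = core (Suc (length p)) (ext p) t s"
  shows "flip_perm t s (flip_perm t s p) = p"
proof (rule eq_of_ext)
  show "ext (flip_perm t s (flip_perm t s p)) = ext p"
    unfolding ext_flip_perm[of t s "flip_perm t s p"] length_flip_perm assms
    unfolding ext_flip_perm by (simp add: fun_eq_iff flip_flip finite_core)
qed simp

text \<open>\<open>flip_perm\<close> maps each class into the other and, as it preserves the core on
  both, is its own inverse there.\<close>

lemma card_gap_perms:
  "card {p \<in> perms n. down_gap (Suc n) (ext p) t s} =
   card {p \<in> perms n. up_gap (Suc n) (ext p) t s \<and> no_overlap (Suc n) (ext p) t s}" (is "card ?A = card ?B")
proof -
  let ?f = "flip_perm t s"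
  have A: "core (Suc n) (ext (?f p)) t s = core (Suc n) (ext p) t s \<and> ?f p \<in> ?B" if "p \<in> ?A" for p
  proof -
    interpret chains "Suc n" t s "ext p" .
    have l: "length p = n" using that length_perms by blast
    have e: "ext (?f p) = P'" using ext_flip_perm l by (simp add: P'_def \<sigma>_def)
    show ?thesis using that core_flip_down up_gap_flip no_overlap_flip flip_perm_in_perms[of p n t s]
      by (simp add: e)
  qed
  have B: "core (Suc n) (ext (?f p)) t s = core (Suc n) (ext p) t s \<and> ?f p \<in> ?A" if "p \<in> ?B" for p
  proof -
    interpret chains "Suc n" t s "ext p" .
    have l: "length p = n" using that length_perms by blast
    have e: "ext (?f p) = P'" using ext_flip_perm l by (simp add: P'_def \<sigma>_def)
    have "inj_on (ext p) {0..Suc n}" using that inj_ext by blast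
    then show ?thesis using that core_flip_up down_gap_flip flip_perm_in_perms[of p n t s]
      by (simp add: e)
  qed
  have "?f (?f p) = p" if "p \<in> ?A \<union> ?B" for p
    using A[of p] B[of p] that flip_perm_flip_perm[of p t s] length_perms[of p n] by auto
  then have "bij_betw ?f ?A ?B"
    using A B by (intro bij_betw_byWitness[where f' = ?f]) blast+
  then show ?thesis by (rule bij_betw_same_card)
qed

section \<open>Patterns that witness an overlap\<close>

text \<open>Standardization: each selected entry is replaced by its rank among the selected
  entries.\<close>

lemma pattern_exists:
  fixes p :: "nat list"
  assumes d: "distinct p" and f: "inj_on f {..<m}" "\<And>a. a < m \<Longrightarrow> f a < length p"
  obtains q where "q \<in> perms m" "\<And>a b. a < m \<Longrightarrow> b < m \<Longrightarrow> q ! a < q ! b \<longleftrightarrow> p ! f a < p ! f b"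
proof
  define B where "B a = {b. b < m \<and> p ! f b \<le> p ! f a}" for a
  define q where "q = map (\<lambda>a. card (B a)) [0..<m]"
  have fin: "finite (B a)" for a unfolding B_def by simp
  have less: "card (B a) < card (B b)" if "a < m" "b < m" "p ! f a < p ! f b" for a b
  proof (rule psubset_card_mono[OF fin])
    have "b \<in> B b" "b \<notin> B a" using that by (auto simp: B_def)
    moreover have "B a \<subseteq> B b" using that by (auto simp: B_def)
    ultimately show "B a \<subset> B b" by blast
  qed
  have ne: "p ! f a \<noteq> p ! f b" if "a < m" "b < m" "a \<noteq> b" for a b
    using that d f nth_eq_iff_index_eq[of p "f a" "f b"] by (auto dest: inj_onD)
  have iff: "card (B a) < card (B b) \<longleftrightarrow> p ! f a < p ! f b" if "a < m" "b < m" for a b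
    using less[of a b] less[of b a] ne[of a b] that
    by (cases "a = b") (auto simp: neq_iff)
  have dq: "distinct q"
    unfolding q_def distinct_map
    by (auto intro!: inj_onI) (metis less ne nat_neq_iff)
  have "1 \<le> card (B a) \<and> card (B a) \<le> m" if "a < m" for a
  proof -
    have "a \<in> B a" using that by (simp add: B_def)
    then have "card (B a) \<noteq> 0" using fin by auto
    moreover have "card (B a) \<le> card {..<m}" by (rule card_mono) (auto simp: B_def)
    ultimately show ?thesis by simp
  qed
  then have "set q \<subseteq> {1..m}" by (auto simp: q_def)
  moreover have "card (set q) = m" using distinct_card[OF dq] by (simp add: q_def)
  ultimately have "set q = {1..m}" by (intro card_subset_eq) auto
  then show "q \<in> perms m" using dq perms_iff by blast
  show "q ! a < q ! b \<longleftrightarrow> p ! f a < p ! f b" if "a < m" "b < m" for a b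
    using iff that by (simp add: q_def)
qed

text \<open>Turns an occurrence \<open>f\<close>, given by list indices from 0, into a map of
  positions counted from 1 that also matches the sentinels of pattern and permutation.\<close>

definition pos_embed :: "nat \<Rightarrow> nat \<Rightarrow> (nat \<Rightarrow> nat) \<Rightarrow> nat \<Rightarrow> nat" where
  "pos_embed m n f a = (if a = 0 then 0 else if a \<le> m then Suc (f (a - 1)) else Suc n)"

lemma pos_embed_less_iff:
  assumes "strict_mono_on {..<m} f" "\<And>a. a < m \<Longrightarrow> f a < n" "x \<le> Suc m" "y \<le> Suc m"
  shows "pos_embed m n f x < pos_embed m n f y \<longleftrightarrow> x < y"
proof -
  have *: "pos_embed m n f x < pos_embed m n f y" if "x < y" "y \<le> Suc m" for x y
    using that assms(2)[of "x - 1"] strict_mono_onD[OF assms(1), of "x - 1" "y - 1"]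
    by (auto simp: pos_embed_def)
  show ?thesis using *[of x y] *[of y x] assms(3,4) by (cases x y rule: linorder_cases) auto
qed

text \<open>The sentinels have the smallest and the largest value on both sides, so the comparisons
  of the occurrence extend to them.\<close>

lemma ext_pos_embed_less_iff:
  assumes p: "p \<in> perms n" and q: "q \<in> perms m"
    and f: "strict_mono_on {..<m} f" "\<And>a. a < m \<Longrightarrow> f a < n"
    "\<And>a b. a < m \<Longrightarrow> b < m \<Longrightarrow> q ! a < q ! b \<longleftrightarrow> p ! f a < p ! f b"
    and xy: "x \<le> Suc m" "y \<le> Suc m"
  shows "ext p (pos_embed m n f x) < ext p (pos_embed m n f y) \<longleftrightarrow> ext q x < ext q y"
proof -
  have l: "length p = n" "length q = m" using p q length_perms by auto
  have c: "z = 0 \<and> ext q z = 0 \<and> ext p (pos_embed m n f z) = 0 \<or>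
      z = Suc m \<and> ext q z = Suc m \<and> ext p (pos_embed m n f z) = Suc n \<or>
      z - 1 < m \<and> ext q z = q ! (z - 1) \<and> ext p (pos_embed m n f z) = p ! f (z - 1) \<and>
      0 < ext q z \<and> ext q z < Suc m \<and> 0 < ext p (pos_embed m n f z) \<and> ext p (pos_embed m n f z) < Suc n"
    if z: "z \<le> Suc m" for z
  proof -
    consider "z = 0" | "z = Suc m" | a where "z = Suc a" "a < m"
      using z that by (cases z) (auto simp: le_less)
    then show ?thesis
    proof cases
      case 3
      then show ?thesis using nth_perms[OF q, of a] nth_perms[OF p, of "f a"] f(2)[of a] l
        by (simp add: ext_def pos_embed_def Suc_le_eq less_Suc_eq_le)
    qed (use l in \<open>simp_all add: ext_def pos_embed_def\<close>)
  qed
  show ?thesis using c[OF xy(1)] c[OF xy(2)] f(3)[of "x - 1" "y - 1"] by (elim disjE) auto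
qed

lemma asc_pos_embed_iff:
  assumes p: "p \<in> perms n" and q: "q \<in> perms m"
    and f: "strict_mono_on {..<m} f" "\<And>a. a < m \<Longrightarrow> f a < n"
    "\<And>a b. a < m \<Longrightarrow> b < m \<Longrightarrow> q ! a < q ! b \<longleftrightarrow> p ! f a < p ! f b"
    and xy: "x \<le> Suc m" "y \<le> Suc m"
  shows "(pos_embed m n f x, pos_embed m n f y) \<in> asc (Suc n) (ext p) \<longleftrightarrow> (x, y) \<in> asc (Suc m) (ext q)"
proof -
  have "pos_embed m n f y \<le> Suc n"
    using f(2)[of "y - 1"] by (cases y) (auto simp: pos_embed_def)
  then show ?thesis
    using ext_pos_embed_less_iff[OF p q f xy] pos_embed_less_iff[OF f(1,2) xy] xy by (simp add: asc_def)
qed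

text \<open>A violation consists of comparisons of positions and values only, so an occurrence of
  \<open>q\<close> carries a violation in \<open>q\<close> to one in \<open>p\<close>.\<close>

lemma no_overlap_contains:
  assumes p: "p \<in> perms n" and q: "q \<in> perms m" and "contains p q"
    and no: "no_overlap (Suc n) (ext p) t s"
  shows "no_overlap (Suc m) (ext q) t s"
  unfolding no_overlap_def
proof (intro allI impI notI)
  have l: "length p = n" "length q = m" using p q length_perms by auto
  obtain f where f: "strict_mono_on {..<m} f" "\<And>a. a < m \<Longrightarrow> f a < n"
    "\<And>a b. a < m \<Longrightarrow> b < m \<Longrightarrow> q ! a < q ! b \<longleftrightarrow> p ! f a < p ! f b"
    using assms(3) l unfolding contains_def by auto
  let ?g = "pos_embed m n f" and ?R = "asc (Suc m) (ext q)" and ?S = "asc (Suc n) (ext p)"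
  have g: "(?g x, ?g y) \<in> ?S" if "(x, y) \<in> ?R" for x y
    using that asc_pos_embed_iff[OF p q f, of x y] by (simp add: asc_def)
  have gr: "(?g x, ?g y) \<in> ?S ^^ r" if "(x, y) \<in> ?R ^^ r" for x y r
    using that g by (rule relpow_map)
  have [simp]: "?g 0 = 0" "?g (Suc m) = Suc n" by (simp_all add: pos_embed_def)
  fix v w e y
  assume a: "(0, v) \<in> ?R ^^ t" "(0, w) \<in> ?R ^^ Suc t" "v < w" "w < e" "(v, e) \<in> ?R" "(e, y) \<in> ?R"
    "(y, Suc m) \<in> ?R ^^ s" "ext q w < ext q v"
  have b: "v \<le> Suc m" "w \<le> Suc m" "e \<le> Suc m" using a by (auto simp: asc_def)
  have "?g v < ?g w" "?g w < ?g e" "ext p (?g w) < ext p (?g v)"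
    using pos_embed_less_iff[OF f(1,2)] ext_pos_embed_less_iff[OF p q f] a b by auto
  then show False
    using no gr[OF a(1)] gr[OF a(2)] g[OF a(5)] g[OF a(6)] gr[OF a(7)]
    unfolding no_overlap_def by auto
qed

text \<open>A chain of \<open>r\<close> links visits at most \<open>Suc r\<close> points.
  Restricting the relation to them lets the chain pass to the pattern that they induce.\<close>

lemma relpow_finite_support:
  assumes "(a, b) \<in> R ^^ r"
  obtains W where "finite W" "card W \<le> Suc r" "a \<in> W" "b \<in> W" "(a, b) \<in> (R \<inter> W \<times> W) ^^ r"
proof -
  obtain g where g: "g 0 = a" "g r = b" "\<forall>i<r. (g i, g (Suc i)) \<in> R"
    using assms unfolding relpow_fun_conv by blast
  let ?W = "g ` {..r}"
  have "card ?W \<le> Suc r" using card_image_le[of "{..r}" g] by simp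
  moreover have "(a, b) \<in> (R \<inter> ?W \<times> ?W) ^^ r"
    unfolding relpow_fun_conv using g by (intro exI[of _ g]) auto
  ultimately show ?thesis using that[of ?W] g by auto
qed

text \<open>The pattern is induced by the points of the three chains of a violation together with e.\<close>

lemma no_overlap_witness:
  assumes p: "p \<in> perms n" and no: "\<not> no_overlap (Suc n) (ext p) t s"
  obtains m q where "m \<le> 2 * t + s + 8" "q \<in> perms m" "contains p q" "\<not> no_overlap (Suc m) (ext q) t s"
proof -
  let ?S = "asc (Suc n) (ext p)"
  have lp: "length p = n" using p length_perms by auto
  obtain v w e y where a: "(0, v) \<in> ?S ^^ t" "(0, w) \<in> ?S ^^ Suc t" "v < w" "w < e"
    "(v, e) \<in> ?S" "(e, y) \<in> ?S" "(y, Suc n) \<in> ?S ^^ s" "ext p w < ext p v"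
    using no unfolding no_overlap_def by blast
  obtain W1 where W1: "finite W1" "card W1 \<le> Suc t" "0 \<in> W1" "v \<in> W1" "(0, v) \<in> (?S \<inter> W1 \<times> W1) ^^ t"
    using relpow_finite_support[OF a(1)] .
  obtain W2 where W2: "finite W2" "card W2 \<le> Suc (Suc t)" "0 \<in> W2" "w \<in> W2"
    "(0, w) \<in> (?S \<inter> W2 \<times> W2) ^^ Suc t"
    using relpow_finite_support[OF a(2)] .
  obtain W3 where W3: "finite W3" "card W3 \<le> Suc s" "y \<in> W3" "Suc n \<in> W3"
    "(y, Suc n) \<in> (?S \<inter> W3 \<times> W3) ^^ s"
    using relpow_finite_support[OF a(7)] .
  \<comment> \<open>The supports are only known to be finite sets containing the chains, so anything
    beyond the sentinel \<open>Suc n\<close> is cut off.\<close>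
  define W where "W = (W1 \<union> W2 \<union> W3 \<union> {e}) \<inter> {..Suc n}"
  \<comment> \<open>The sentinels are dropped and positions become list indices counted from
    0.\<close>
  define V where "V = (\<lambda>x. x - 1) ` (W \<inter> {1..n})"
  define m where "m = card V"
  define f where "f = (!) (sorted_list_of_set V)"
  have finV: "finite V" by (simp add: V_def)
  have len: "length (sorted_list_of_set V) = m" by (simp add: m_def)
  have fim: "f ` {..<m} = V"
    using set_sorted_list_of_set[OF finV] unfolding f_def set_conv_nth len by auto
  have Vn: "V \<subseteq> {..<n}" by (auto simp: V_def)
  have f1: "strict_mono_on {..<m} f"
    using sorted_list_of_set.strict_sorted_key_list_of_set[of V] len
    unfolding f_def by (auto intro!: strict_mono_onI simp: sorted_wrt_iff_nth_less)
  have f2: "f a < n" if "a < m" for a using fim Vn that by blast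
  have "inj_on f {..<m}" using f1 strict_mono_on_imp_inj_on by blast
  then obtain q where q: "q \<in> perms m"
    "\<And>a b. a < m \<Longrightarrow> b < m \<Longrightarrow> q ! a < q ! b \<longleftrightarrow> p ! f a < p ! f b"
    using pattern_exists[of p f m] p f2 lp perms_iff by auto
  have lq: "length q = m" using q length_perms by blast
  have "card W \<le> card (W1 \<union> W2 \<union> W3 \<union> {e})" unfolding W_def by (rule card_mono) (use W1 W2 W3 in auto)
  also have "\<dots> \<le> card W1 + card W2 + card W3 + card {e}"
    by (meson card_Un_le add_le_mono order.trans order_refl)
  \<comment> \<open>The three supports and \<open>e\<close> contribute at most t + 1, t + 2, s + 1
    and 1 points; any bound in terms of \<open>t\<close> and \<open>s\<close> would serve.\<close>
  finally have "card W \<le> 2 * t + s + 8" using W1 W2 W3 by simp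
  moreover have "m \<le> card W"
  proof -
    have "m \<le> card (W \<inter> {1..n})" unfolding m_def V_def by (rule card_image_le) simp
    also have "\<dots> \<le> card W" by (rule card_mono) (auto simp: W_def)
    finally show ?thesis .
  qed
  ultimately have bound: "m \<le> 2 * t + s + 8" by simp
  let ?g = "pos_embed m n f" and ?R = "asc (Suc m) (ext q)"
  have "\<exists>z\<le>Suc m. ?g z = x" if "x \<in> W" for x
  proof -
    consider "x = 0" | "x = Suc n" | "x \<in> W \<inter> {1..n}" using \<open>x \<in> W\<close> by (fastforce simp: W_def)
    then show ?thesis
    proof cases
      case 3
      then have "x - 1 \<in> V" by (auto simp: V_def)
      then obtain a where "a < m" "f a = x - 1" using fim by auto
      then show ?thesis using 3 by (intro exI[of _ "Suc a"]) (simp add: pos_embed_def)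
    next
      case 1
      then show ?thesis by (intro exI[of _ 0]) (simp add: pos_embed_def)
    next
      case 2
      then show ?thesis by (intro exI[of _ "Suc m"]) (simp add: pos_embed_def)
    qed
  qed
  \<comment> \<open>\<open>h\<close> locates the points of the violation in the pattern, sentinels
    included.\<close>
  then obtain h where h: "\<And>x. x \<in> W \<Longrightarrow> h x \<le> Suc m \<and> ?g (h x) = x" by metis
  have less: "h x < h z \<longleftrightarrow> x < z" if "x \<in> W" "z \<in> W" for x z
    using pos_embed_less_iff[OF f1 f2, of "h x" "h z"] h that by simp
  have ext_less: "ext q (h x) < ext q (h z) \<longleftrightarrow> ext p x < ext p z" if "x \<in> W" "z \<in> W" for x z
    using ext_pos_embed_less_iff[OF p q(1) f1 f2 q(2), of "h x" "h z"] h that by simp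
  have hR: "(h x, h z) \<in> ?R" if "(x, z) \<in> ?S" "x \<in> W" "z \<in> W" for x z
    using that asc_pos_embed_iff[OF p q(1) f1 f2 q(2), of "h x" "h z"] h by simp
  have hRr: "(h x, h z) \<in> ?R ^^ r" if "(x, z) \<in> (?S \<inter> U \<times> U) ^^ r" "U \<subseteq> W1 \<union> W2 \<union> W3" for x z r U
    using that(1)
  proof (rule relpow_map)
    fix x z assume xz: "(x, z) \<in> ?S \<inter> U \<times> U"
    then have "x \<le> Suc n" "z \<le> Suc n" by (auto simp: asc_def)
    then have "x \<in> W" "z \<in> W" using xz that(2) by (auto simp: W_def)
    then show "(h x, h z) \<in> ?R" using hR xz by blast
  qed
  have mem: "0 \<in> W" "Suc n \<in> W" "v \<in> W" "w \<in> W" "e \<in> W" "y \<in> W"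
    using W1 W2 W3 a by (auto simp: W_def asc_def)
  have h0: "h 0 = 0"
    using h[OF mem(1)] by (auto simp: pos_embed_def split: if_splits)
  have "?g (Suc m) = Suc n" by (simp add: pos_embed_def)
  then have hN: "h (Suc n) = Suc m"
    using h[OF mem(2)] pos_embed_less_iff[OF f1 f2, of "h (Suc n)" "Suc m"] by simp
  have "\<not> no_overlap (Suc m) (ext q) t s"
  proof
    assume "no_overlap (Suc m) (ext q) t s"
    moreover have "(0, h v) \<in> ?R ^^ t" "(0, h w) \<in> ?R ^^ Suc t" "(h y, Suc m) \<in> ?R ^^ s"
      using hRr[OF W1(5)] hRr[OF W2(5)] hRr[OF W3(5)] unfolding h0 hN by blast+
    moreover have "h v < h w" "h w < h e" "ext q (h w) < ext q (h v)"
      using less ext_less mem a by blast+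
    moreover have "(h v, h e) \<in> ?R" "(h e, h y) \<in> ?R" using hR a mem by blast+
    ultimately show False unfolding no_overlap_def by blast
  qed
  moreover have "contains p q"
    unfolding contains_def lp lq using f1 f2 q(2) by blast
  ultimately show ?thesis using that bound q(1) by blast
qed

section \<open>Avoidance of the sets M in terms of chains\<close>

text \<open>Translates an index of the word with entry \<open>J\<close> deleted into an index of the
  full word, both counted from 0.\<close>

definition skip :: "nat \<Rightarrow> nat \<Rightarrow> nat" where
  "skip J a = (if a < J then a else Suc a)"

lemma skip_image: "J \<le> k \<Longrightarrow> skip J ` {..<k} = {..k} - {J}"
proof
  assume J: "J \<le> k"
  show "{..k} - {J} \<subseteq> skip J ` {..<k}"
  proof
    fix b assume "b \<in> {..k} - {J}"
    then show "b \<in> skip J ` {..<k}"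
      using J by (intro image_eqI[of _ _ "if b < J then b else b - 1"]) (auto simp: skip_def)
  qed
qed (auto simp: skip_def)

lemma inj_skip: "inj_on (skip J) A"
  by (auto simp: inj_on_def skip_def split: if_splits)

text \<open>Hence the condition that the deleted entry is not i only involves comparisons, and so can be
  read off from an occurrence of the pattern.\<close>

lemma entry_eq_card:
  assumes q: "q \<in> perms (Suc k)" and J: "J \<le> k"
  shows "q ! J = Suc (card {a \<in> {..<k}. q ! skip J a < q ! J})"
proof -
  have l: "length q = Suc k" and d: "distinct q" and s: "set q = {1..Suc k}"
    using q length_perms perms_iff by auto
  let ?A = "{a \<in> {..<k}. q ! skip J a < q ! J}"
  have "(!) q ` skip J ` ?A = {1..<q ! J}"
  proof
    show "(!) q ` skip J ` ?A \<subseteq> {1..<q ! J}"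
      using nth_perms[OF q] by (force simp: skip_def)
    show "{1..<q ! J} \<subseteq> (!) q ` skip J ` ?A"
    proof
      fix z assume z: "z \<in> {1..<q ! J}"
      then have "z \<in> set q" using nth_perms[OF q, of J] J s by simp
      then obtain b where b: "b \<le> k" "q ! b = z" using l by (auto simp: in_set_conv_nth less_Suc_eq_le)
      then have "b \<in> skip J ` {..<k}" using z skip_image[OF J] by auto
      then show "z \<in> (!) q ` skip J ` ?A" using b z by auto
    qed
  qed
  moreover have "inj_on ((!) q) (skip J ` ?A)"
    using d l by (auto simp: inj_on_def nth_eq_iff_index_eq skip_def)
  ultimately have "card ?A = card {1..<q ! J}"
    using card_image[OF inj_skip, of J ?A] card_image[of "(!) q" "skip J ` ?A"] by simp
  then show ?thesis using nth_perms[OF q, of J] J by simp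
qed

lemma M_iff:
  assumes J: "J \<le> k"
  shows "q \<in> M k (Suc J) i \<longleftrightarrow> q \<in> perms (Suc k) \<and> q ! J \<noteq> i \<and>
    (\<forall>a b. a < b \<longrightarrow> b < k \<longrightarrow> q ! skip J a < q ! skip J b)"
proof (cases "q \<in> perms (Suc k)")
  case True
  then have l: "length q = Suc k" using length_perms by blast
  define w where "w = take J q @ drop (Suc J) q"
  have "length w = k" using l J by (simp add: w_def)
  moreover have "w ! a = q ! skip J a" if "a < k" for a
    using that l J by (simp add: nth_append skip_def w_def)
  ultimately have "sorted_wrt (<) w \<longleftrightarrow> (\<forall>a b. a < b \<longrightarrow> b < k \<longrightarrow> q ! skip J a < q ! skip J b)"
    by (auto simp: sorted_wrt_iff_nth_less)
  then show ?thesis using True by (simp add: M_def w_def)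
qed (simp add: M_def)

text \<open>By \<open>entry_eq_card\<close>, membership in \<open>M\<close> depends only on
  comparisons, so the search for a pattern becomes a search for positions \<open>f\<close>. The
  value \<open>Suc m\<close> means that exactly \<open>m\<close> of the other entries are
  smaller.\<close>

lemma contains_M_iff:
  assumes p: "p \<in> perms n" and J: "J \<le> k"
  shows "(\<exists>q\<in>M k (Suc J) (Suc m). contains p q) \<longleftrightarrow>
    (\<exists>f. strict_mono_on {..<Suc k} f \<and> (\<forall>a<Suc k. f a < n) \<and>
      (\<forall>a b. a < b \<longrightarrow> b < k \<longrightarrow> p ! f (skip J a) < p ! f (skip J b)) \<and>
      card {a \<in> {..<k}. p ! f (skip J a) < p ! f J} \<noteq> m)" (is "_ \<longleftrightarrow> (\<exists>f. ?P f)")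
proof -
  have lp: "length p = n" and dp: "distinct p" using p length_perms perms_iff by auto
  have skip: "skip J a < Suc k" if "a < k" for a using that by (simp add: skip_def)
  have main: "q \<in> M k (Suc J) (Suc m) \<longleftrightarrow> ?P f"
    if q: "q \<in> perms (Suc k)" and f: "strict_mono_on {..<Suc k} f" "\<forall>a<Suc k. f a < n"
      and iff: "\<And>a b. a < Suc k \<Longrightarrow> b < Suc k \<Longrightarrow> q ! a < q ! b \<longleftrightarrow> p ! f a < p ! f b" for q f
  proof -
    have "q ! skip J a < q ! skip J b \<longleftrightarrow> p ! f (skip J a) < p ! f (skip J b)" if "a < b" "b < k" for a b
      using iff[OF skip skip] that by simp
    moreover have "{a \<in> {..<k}. q ! skip J a < q ! J} = {a \<in> {..<k}. p ! f (skip J a) < p ! f J}"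
      using iff[OF skip, of _ J] J by auto
    ultimately show ?thesis using q f entry_eq_card[OF q J] unfolding M_iff[OF J] by auto
  qed
  show ?thesis
  proof
    assume "\<exists>q\<in>M k (Suc J) (Suc m). contains p q"
    then obtain q where q: "q \<in> M k (Suc J) (Suc m)" "contains p q" by blast
    have qp: "q \<in> perms (Suc k)" using q M_iff[OF J] by blast
    then have lq: "length q = Suc k" by (rule length_perms)
    obtain f where "strict_mono_on {..<Suc k} f" "\<forall>a<Suc k. f a < n"
      "\<And>a b. a < Suc k \<Longrightarrow> b < Suc k \<Longrightarrow> q ! a < q ! b \<longleftrightarrow> p ! f a < p ! f b"
      using q(2) unfolding contains_def lp lq by blast
    then have "?P f" using main[OF qp] q(1) by blast
    then show "\<exists>f. ?P f" by blast
  next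
    assume "\<exists>f. ?P f"
    then obtain f where f: "?P f" by blast
    have "inj_on f {..<Suc k}" using f strict_mono_on_imp_inj_on by blast
    moreover have "\<And>a. a < Suc k \<Longrightarrow> f a < length p" using f lp by blast
    ultimately obtain q where q: "q \<in> perms (Suc k)"
      "\<And>a b. a < Suc k \<Longrightarrow> b < Suc k \<Longrightarrow> q ! a < q ! b \<longleftrightarrow> p ! f a < p ! f b"
      using pattern_exists[OF dp] by metis
    have lq: "length q = Suc k" using q(1) by (rule length_perms)
    have "q \<in> M k (Suc J) (Suc m)" using main[OF q(1) _ _ q(2)] f by blast
    moreover have "contains p q" unfolding contains_def lp lq using q(2) f by blast
    ultimately show "\<exists>q\<in>M k (Suc J) (Suc m). contains p q" by blast
  qed
qed

lemma Suc_less_imp_less: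
  fixes g :: "nat \<Rightarrow> nat"
  assumes "\<And>a. a \<le> k \<Longrightarrow> g a < g (Suc a)"
  shows "a < b \<Longrightarrow> b \<le> Suc k \<Longrightarrow> g a < g b"
proof (induction b)
  case (Suc b)
  then show ?case using assms[of b] by (cases "a = b") auto
qed simp

text \<open>\<open>z\<close> lies in exactly one gap, between some \<open>g r\<close> and
  \<open>g (Suc r)\<close>; the inner terms below it are then those with indices 1 to r.\<close>

lemma card_below_eq_iff:
  fixes g :: "nat \<Rightarrow> nat"
  assumes g: "\<And>a. a \<le> k \<Longrightarrow> g a < g (Suc a)" and z: "g 0 < z" "z < g (Suc k)"
    "\<And>a. a \<le> Suc k \<Longrightarrow> g a \<noteq> z" and m: "m \<le> k"
  shows "card {a \<in> {..<k}. g (Suc a) < z} = m \<longleftrightarrow> g m < z \<and> z < g (Suc m)"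
proof -
  have *: "card {a \<in> {..<k}. g (Suc a) < z} = m" if "g m < z" "z < g (Suc m)" "m \<le> k" for m
  proof -
    have "{a \<in> {..<k}. g (Suc a) < z} = {..<m}"
    proof
      have "a < m" if "a < k" "g (Suc a) < z" for a
        using Suc_less_imp_less[where g = g and k = k, OF g, of "Suc m" "Suc a"] that \<open>z < g (Suc m)\<close>
        by (cases a m rule: linorder_cases) auto
      then show "{a \<in> {..<k}. g (Suc a) < z} \<subseteq> {..<m}" by auto
      have "g (Suc a) < z" if "a < m" for a
        using Suc_less_imp_less[where g = g and k = k, OF g, of "Suc a" m] that \<open>g m < z\<close> \<open>m \<le> k\<close>
        by (cases "Suc a = m") auto
      then show "{..<m} \<subseteq> {a \<in> {..<k}. g (Suc a) < z}" using \<open>m \<le> k\<close> by auto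
    qed
    then show ?thesis by simp
  qed
  \<comment> \<open>The first term above \<open>z\<close> closes the gap that contains
    \<open>z\<close>.\<close>
  define l where "l = (LEAST a. z < g a)"
  have l: "z < g l" "l \<le> Suc k" unfolding l_def by (rule LeastI Least_le, rule z(2))+
  then obtain r where r: "l = Suc r" using z(1) by (cases l) auto
  have "\<not> z < g r" using not_less_Least[of r "\<lambda>a. z < g a"] r by (simp add: l_def)
  then have gr: "g r < z" "z < g (Suc r)" "r \<le> k" using l r z(3)[of r] by auto
  show ?thesis using *[OF gr] *[of m] m gr by auto
qed

text \<open>The entries other than the one with index \<open>J\<close>, framed by the sentinels,
  form the chain \<open>d\<close>, and the remaining entry is the point \<open>e\<close> between
  \<open>d J\<close> and \<open>d (Suc J)\<close>. Its rank turns into the gap of values that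
  contains it.\<close>

lemma pattern_iff_chain:
  assumes p: "p \<in> perms n" and J: "J \<le> k" and m: "m \<le> k"
  shows "(\<exists>f. strict_mono_on {..<Suc k} f \<and> (\<forall>a<Suc k. f a < n) \<and>
      (\<forall>a b. a < b \<longrightarrow> b < k \<longrightarrow> p ! f (skip J a) < p ! f (skip J b)) \<and>
      card {a \<in> {..<k}. p ! f (skip J a) < p ! f J} \<noteq> m) \<longleftrightarrow>
    (\<exists>d e. d 0 = 0 \<and> d (Suc k) = Suc n \<and> (\<forall>a\<le>k. (d a, d (Suc a)) \<in> asc (Suc n) (ext p)) \<and>
      d J < e \<and> e < d (Suc J) \<and> \<not> (ext p (d m) < ext p e \<and> ext p e < ext p (d (Suc m))))"
    (is "(\<exists>f. ?P f) \<longleftrightarrow> (\<exists>d e. ?Q d e)")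
proof -
  have lp: "length p = n" using p length_perms by blast
  have card: "card {a \<in> {..<k}. p ! f (skip J a) < p ! f J} = m \<longleftrightarrow>
      ext p (d m) < ext p e \<and> ext p e < ext p (d (Suc m))"
    if f: "\<And>a. a < k \<Longrightarrow> d (Suc a) = Suc (f (skip J a)) \<and> f (skip J a) < n"
      and d: "d 0 = 0" "d (Suc k) = Suc n" "\<And>a. a \<le> k \<Longrightarrow> (d a, d (Suc a)) \<in> asc (Suc n) (ext p)"
      and e: "e = Suc (f J)" "d J < e" "e < d (Suc J)" for f d e
  proof -
    have inc: "d a < d b" if "a < b" "b \<le> Suc k" for a b
      by (rule Suc_less_imp_less[where g = d and k = k, OF _ that]) (use d(3) in \<open>auto simp: asc_def\<close>)
    have "d (Suc J) \<le> Suc n" using inc[of "Suc J" "Suc k"] d(2) J by (cases "J = k") auto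
    then have en: "1 \<le> e" "e \<le> n" using e by auto
    have ne: "d a \<noteq> e" if "a \<le> Suc k" for a
    proof (cases "a \<le> J")
      case True then show ?thesis using inc[of a J] e J by (cases "a = J") auto
    next
      case False then show ?thesis using inc[of "Suc J" a] e that by (cases "a = Suc J") auto
    qed
    have dn: "d a \<le> Suc n" if "a \<le> Suc k" for a
      using inc[of a "Suc k"] d(2) that by (cases "a = Suc k") auto
    have "card {a \<in> {..<k}. ext p (d (Suc a)) < ext p e} = m \<longleftrightarrow>
      ext p (d m) < ext p e \<and> ext p e < ext p (d (Suc m))"
    proof (rule card_below_eq_iff)
      show "ext p (d a) < ext p (d (Suc a))" if "a \<le> k" for a using d(3)[OF that] by (simp add: asc_def)
      show "ext p (d 0) < ext p e" "ext p e < ext p (d (Suc k))"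
        using ext_range[OF p en] d by (auto simp: ext_def lp)
      show "ext p (d a) \<noteq> ext p e" if "a \<le> Suc k" for a
        using inj_onD[OF inj_ext[OF p], of "d a" e] ne[OF that] dn[OF that] en by auto
    qed (rule m)
    moreover have "{a \<in> {..<k}. ext p (d (Suc a)) < ext p e} = {a \<in> {..<k}. p ! f (skip J a) < p ! f J}"
      using f e en by (auto simp: ext_Suc lp)
    ultimately show ?thesis by simp
  qed
  show ?thesis
  proof
    assume "\<exists>f. ?P f"
    then obtain f where f: "?P f" by blast
    define d where "d a = (if a = 0 then 0 else if a \<le> k then Suc (f (skip J (a - 1))) else Suc n)" for a
    have fn: "f (skip J a) < n" if "a < k" for a using f that by (simp add: skip_def)
    have fm: "f (skip J a) < f (skip J (Suc a))" if "Suc a < k" for a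
      using strict_mono_onD[of "{..<Suc k}" f "skip J a" "skip J (Suc a)"] f that by (simp add: skip_def)
    have pr: "0 < p ! a" "p ! a < Suc n" if "a < n" for a using nth_perms[OF p that] by auto
    have dS: "d (Suc a) = Suc (f (skip J a)) \<and> f (skip J a) < n" if "a < k" for a
      using that fn by (simp add: d_def)
    have d0: "d 0 = 0" "d (Suc k) = Suc n" by (simp_all add: d_def)
    have st: "(d a, d (Suc a)) \<in> asc (Suc n) (ext p)" if ak: "a \<le> k" for a
    proof -
      consider "a = 0" "k = 0" | "a = 0" "0 < k" | b where "a = Suc b" "Suc b < k" | b where "a = Suc b" "a = k"
        using ak that by (cases a) (auto simp: le_less)
      then show ?thesis
      proof cases
        case 1 then show ?thesis by (simp add: asc_def d_def ext_def lp)
      next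
        case 2 then show ?thesis using dS[of 0] d0 pr by (simp add: asc_def ext_Suc lp ext_0)
      next
        case 3 then show ?thesis using dS[of b] dS[of "Suc b"] fm[of b] f by (simp add: asc_def ext_Suc lp)
      next
        case 4 then show ?thesis using dS[of b] d0 pr by (simp add: asc_def ext_Suc lp ext_above)
      qed
    qed
    have "d J < Suc (f J)"
    proof (cases J)
      case (Suc b)
      then show ?thesis using dS[of b] J strict_mono_onD[of "{..<Suc k}" f b J] f by (simp add: skip_def)
    qed (simp add: d_def)
    moreover have "Suc (f J) < d (Suc J)"
    proof (cases "J = k")
      case False
      then show ?thesis using dS[of J] J strict_mono_onD[of "{..<Suc k}" f J "Suc J"] f by (simp add: skip_def)
    qed (use d0 f in simp)
    ultimately show "\<exists>d e. ?Q d e" using card[where f = f and d = d, OF dS d0 st refl] f d0 st by blast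
  next
    assume "\<exists>d e. ?Q d e"
    then obtain d e where Q: "d 0 = 0" "d (Suc k) = Suc n"
      "\<And>a. a \<le> k \<Longrightarrow> (d a, d (Suc a)) \<in> asc (Suc n) (ext p)" "d J < e" "e < d (Suc J)"
      "\<not> (ext p (d m) < ext p e \<and> ext p e < ext p (d (Suc m)))" by blast
    have inc: "d a < d b" if "a < b" "b \<le> Suc k" for a b
      by (rule Suc_less_imp_less[where g = d and k = k, OF _ that]) (use Q in \<open>auto simp: asc_def\<close>)
    have incp: "ext p (d a) < ext p (d b)" if "a < b" "b \<le> Suc k" for a b
      by (rule Suc_less_imp_less[where g = "\<lambda>a. ext p (d a)" and k = k, OF _ that]) (use Q in \<open>auto simp: asc_def\<close>)
    \<comment> \<open>\<open>e\<close> is inserted at index \<open>J\<close> among the genuine terms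
      of \<open>d\<close>. Before \<open>J\<close> the indices differ by one because of the sentinel
      \<open>d 0\<close>; after \<open>J\<close> the inserted point makes up for this.\<close>
    define pos where "pos a = (if a < J then d (Suc a) else if a = J then e else d a)" for a
    have mono: "pos a < pos b" if "a < b" "b \<le> k" for a b
    proof -
      have dJ: "d a' \<le> d J" if "a' \<le> J" for a' using inc[of a' J] that J by (cases "a' = J") auto
      have dSJ: "d (Suc J) \<le> d b" if "J < b" using inc[of "Suc J" b] that \<open>b \<le> k\<close> by (cases "b = Suc J") auto
      show ?thesis
        using that inc[of "Suc a" "Suc b"] inc[of "Suc a" b] inc[of a b] dJ[of "Suc a"] dSJ Q
        unfolding pos_def by (cases "Suc a = b") (auto split: if_splits)
    qed
    have bnd: "0 < pos a" "pos a < Suc n" if "a \<le> k" for a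
    proof -
      have "d (Suc J) \<le> Suc n" using inc[of "Suc J" "Suc k"] Q J by (cases "J = k") auto
      then show "0 < pos a" "pos a < Suc n"
        using that inc[of 0 "Suc a"] inc[of 0 a] inc[of a "Suc k"] inc[of "Suc a" "Suc k"] Q J
        unfolding pos_def by (auto split: if_splits)
    qed
    define f where "f a = pos a - 1" for a
    have fpos: "Suc (f a) = pos a" "f a < n" if "a \<le> k" for a using bnd[OF that] by (auto simp: f_def)
    have f1: "strict_mono_on {..<Suc k} f"
      using mono fpos(1) by (intro strict_mono_onI) (metis Suc_less_SucD lessThan_iff less_Suc_eq_le)
    have skip: "skip J a \<le> k" "pos (skip J a) = d (Suc a)" if "a < k" for a
      using that by (auto simp: skip_def pos_def)
    have dS: "d (Suc a) = Suc (f (skip J a)) \<and> f (skip J a) < n" if "a < k" for a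
      using fpos skip that by simp
    have "p ! f (skip J a) < p ! f (skip J b)" if "a < b" "b < k" for a b
      using incp[of "Suc a" "Suc b"] dS[of a] dS[of b] that by (simp add: ext_Suc lp)
    moreover have e: "e = Suc (f J)" using fpos(1)[OF J] by (simp add: pos_def)
    have "card {a \<in> {..<k}. p ! f (skip J a) < p ! f J} \<noteq> m"
      using card[where f = f and d = d, OF dS Q(1-3) e Q(4,5)] Q(6) by blast
    moreover have "\<forall>a<Suc k. f a < n" using fpos(2) less_Suc_eq_le by blast
    ultimately show "\<exists>f. ?P f" using f1 by blast
  qed
qed

text \<open>The sequence \<open>d\<close> is cut at the indices t, t + 1 and t + 2; its k + 1 links
  split as t + 1 + 1 + s.\<close>

lemma split_chain_iff:
  assumes "k = Suc (t + s)"
  shows "(\<exists>v x e y. (0, v) \<in> R ^^ t \<and> (v, x) \<in> R \<and> (x, y) \<in> R \<and> (y, N) \<in> R ^^ s \<and> \<Phi> v x e y) \<longleftrightarrow>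
    (\<exists>d e. d 0 = 0 \<and> d (Suc k) = N \<and> (\<forall>a\<le>k. (d a, d (Suc a)) \<in> R) \<and>
      \<Phi> (d t) (d (Suc t)) e (d (Suc (Suc t))))" (is "?L \<longleftrightarrow> ?R")
proof
  assume ?L
  then obtain v x e y where a: "(0, v) \<in> R ^^ t" "(v, x) \<in> R" "(x, y) \<in> R" "(y, N) \<in> R ^^ s" "\<Phi> v x e y"
    by blast
  obtain g h where g: "g 0 = 0" "g t = v" "\<And>i. i < t \<Longrightarrow> (g i, g (Suc i)) \<in> R"
    and h: "h 0 = y" "h s = N" "\<And>i. i < s \<Longrightarrow> (h i, h (Suc i)) \<in> R"
    using a(1,4) unfolding relpow_fun_conv by blast
  define d where "d i = (if i \<le> t then g i else if i = Suc t then x else h (i - Suc (Suc t)))" for i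
  have "(d i, d (Suc i)) \<in> R" if ik: "i \<le> k" for i
  proof -
    have "i - Suc (Suc t) < s" "i = Suc (Suc t) + (i - Suc (Suc t))" if "\<not> i \<le> Suc t"
      using that ik assms by auto
    then consider "i < t" | "i = t" | "i = Suc t" | r where "i = Suc (Suc t) + r" "r < s"
      by (metis le_Suc_eq le_neq_implies_less)
    then show ?thesis using a g h by cases (auto simp: d_def Suc_diff_le)
  qed
  moreover have "d 0 = 0" "d (Suc k) = N" "d t = v" "d (Suc t) = x" "d (Suc (Suc t)) = y"
    using assms g h by (auto simp: d_def)
  ultimately show ?R using a(5) by metis
next
  assume ?R
  then obtain d e where d: "d 0 = 0" "d (Suc k) = N" "\<And>a. a \<le> k \<Longrightarrow> (d a, d (Suc a)) \<in> R"
    "\<Phi> (d t) (d (Suc t)) e (d (Suc (Suc t)))" by blast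
  have "(0, d t) \<in> R ^^ t" unfolding relpow_fun_conv using d assms by (intro exI[of _ d]) auto
  moreover have "(d (Suc (Suc t)), N) \<in> R ^^ s" unfolding relpow_fun_conv using d assms
    by (intro exI[of _ "\<lambda>a. d (Suc (Suc t) + a)"]) auto
  moreover have "(d t, d (Suc t)) \<in> R" "(d (Suc t), d (Suc (Suc t))) \<in> R" using d(3) assms by auto
  ultimately show ?L using d(4) by blast
qed

text \<open>With \<open>J = Suc t\<close> the point \<open>e\<close> stands between x =
  \<open>d (Suc t)\<close> and y = \<open>d (Suc (Suc t))\<close>. The exempt value
  \<open>Suc m\<close> gives the gap from \<open>v\<close> to \<open>x\<close> for m = t and the gap
  from \<open>x\<close> to \<open>y\<close> for m = t + 1.\<close>

lemma avoids_M_iff: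
  assumes p: "p \<in> perms n" and k: "k = Suc (t + s)"
  shows "(\<forall>q\<in>M k (Suc (Suc t)) (Suc t). avoids p q) \<longleftrightarrow> down_gap (Suc n) (ext p) t s"
    and "(\<forall>q\<in>M k (Suc (Suc t)) (Suc (Suc t)). avoids p q) \<longleftrightarrow> up_gap (Suc n) (ext p) t s"
proof -
  let ?S = "asc (Suc n) (ext p)"
  have *: "Suc t \<le> k" "t \<le> k" using k by auto
  have "(\<exists>q\<in>M k (Suc (Suc t)) (Suc t). contains p q) \<longleftrightarrow>
    (\<exists>v x e y. (0, v) \<in> ?S ^^ t \<and> (v, x) \<in> ?S \<and> (x, y) \<in> ?S \<and> (y, Suc n) \<in> ?S ^^ s \<and>
     (x < e \<and> e < y \<and> \<not> (ext p v < ext p e \<and> ext p e < ext p x)))"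
    unfolding contains_M_iff[OF p *(1)] pattern_iff_chain[OF p *] split_chain_iff[OF k] by blast
  then show "(\<forall>q\<in>M k (Suc (Suc t)) (Suc t). avoids p q) \<longleftrightarrow> down_gap (Suc n) (ext p) t s"
    unfolding avoids_def down_gap_def by blast
  have "(\<exists>q\<in>M k (Suc (Suc t)) (Suc (Suc t)). contains p q) \<longleftrightarrow>
    (\<exists>v x e y. (0, v) \<in> ?S ^^ t \<and> (v, x) \<in> ?S \<and> (x, y) \<in> ?S \<and> (y, Suc n) \<in> ?S ^^ s \<and>
     (x < e \<and> e < y \<and> \<not> (ext p x < ext p e \<and> ext p e < ext p y)))"
    unfolding contains_M_iff[OF p *(1)] pattern_iff_chain[OF p *(1) *(1)] split_chain_iff[OF k] by blast
  then show "(\<forall>q\<in>M k (Suc (Suc t)) (Suc (Suc t)). avoids p q) \<longleftrightarrow> up_gap (Suc n) (ext p) t s"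
    unfolding avoids_def up_gap_def by blast
qed

theorem theorem3p3:
  fixes k j :: nat
  assumes "k \<ge> 2" and "2 \<le> j" and "j \<le> k + 1"
  shows "\<exists>S. finite S \<and> S \<subseteq> (\<Union>m. perms m) \<and> M k j j \<subseteq> S \<and>
           (\<forall>n\<ge>1. card (Av n (M k j (j - 1))) = card (Av n S))"
proof -
  define t where "t = j - 2"
  define s where "s = k + 1 - j"
  have j: "j = Suc (Suc t)" and k: "k = Suc (t + s)" using assms by (auto simp: t_def s_def)
  \<comment> \<open>The length bound is that of \<open>no_overlap_witness\<close> and keeps
    \<open>X\<close> finite. Every violation shows up in a pattern of such a length, and patterns
    inherit \<open>no_overlap\<close>, so avoiding \<open>X\<close> is equivalent to
    \<open>no_overlap\<close>.\<close>
  define X where "X = {q \<in> \<Union>m\<le>2 * t + s + 8. perms m. \<not> no_overlap (Suc (length q)) (ext q) t s}"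
  define S where "S = M k j j \<union> X"
  have M: "M k j j \<subseteq> perms (k + 1)" by (auto simp: M_def)
  have "finite S" unfolding S_def X_def using finite_perms finite_subset[OF M] by simp
  moreover have "S \<subseteq> (\<Union>m. perms m)" using M unfolding S_def X_def by blast
  moreover have "M k j j \<subseteq> S" by (simp add: S_def)
  moreover have "card (Av n (M k j (j - 1))) = card (Av n S)" for n
  proof -
    have "Av n (M k j (j - 1)) = {p \<in> perms n. down_gap (Suc n) (ext p) t s}"
      unfolding Av_def using avoids_M_iff(1)[OF _ k] j by auto
    moreover have X: "(\<forall>q\<in>X. avoids p q) \<longleftrightarrow> no_overlap (Suc n) (ext p) t s" if p: "p \<in> perms n" for p
    proof
      assume av: "\<forall>q\<in>X. avoids p q"
      show "no_overlap (Suc n) (ext p) t s"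
      proof (rule ccontr)
        assume "\<not> ?thesis"
        then obtain m q where q: "m \<le> 2 * t + s + 8" "q \<in> perms m" "contains p q"
          "\<not> no_overlap (Suc m) (ext q) t s"
          using no_overlap_witness[OF p] by metis
        then have "q \<in> X" using length_perms[OF q(2)] by (auto simp: X_def)
        then show False using av q(3) by (simp add: avoids_def)
      qed
    next
      assume no: "no_overlap (Suc n) (ext p) t s"
      show "\<forall>q\<in>X. avoids p q"
      proof
        fix q assume "q \<in> X"
        then obtain m where "q \<in> perms m" "\<not> no_overlap (Suc (length q)) (ext q) t s"
          by (auto simp: X_def)
        then show "avoids p q"
          using no_overlap_contains[OF p, of q m] length_perms[of q m] no by (auto simp: avoids_def)
      qed
    qed
    have "Av n S = {p \<in> perms n. up_gap (Suc n) (ext p) t s \<and> no_overlap (Suc n) (ext p) t s}"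
      unfolding Av_def S_def using avoids_M_iff(2)[OF _ k] X j by blast
    ultimately show ?thesis using card_gap_perms by simp
  qed
  ultimately show ?thesis by blast
qed

end
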